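(* Let $n\geq1$ and let $f$ be a pluriharmonic function of $\mathbb{B}_{\ell_2^n}$ into $\mathbb{D}$. (i) If $n=1$, then for every $z\in\mathbb{B}_{\ell_2^1}=\mathbb{D}$ and every integer $m\geq 1$, $$\left|\frac{\partial^m f(z)}{\partial z^m}\right|+\left|\frac{\partial^m f(z)}{\partial\overline{z}^m}\right|\leq\frac{4}{\pi}\,m!\,\frac{(1+|z|)^{m-1}}{(1-|z|^2)^m}.$$ The constant $4/\pi$ in this inequality cannot be improved. (ii) If $n\geq 2$, then for every $z\in\mathbb{B}_{\ell_2^n}$ and every multi-index $m=(m_1,\ldots,m_n)\neq 0$, $$\left|\frac{\partial^{|m|}f(z)}{\partial z_1^{m_1}\cdots\partial z_n^{m_n}}\right|+\left|\frac{\partial^{|m|}f(z)}{\partial\overline{z}_1^{m_1}\cdots\partial\overline{z}_n^{m_n}}\right|\leq\frac{4}{\pi}\,n^{\frac{|m|}{2}}\binom{n+|m|-1}{n-1}|m|!\,\frac{\prod_{j=1}^n(1+|z_j|)^{m_j}}{(1-\|z\|_2^2)^{|m|}}.$$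
   Context: $\|z\|_2=(\sum_j|z_j|^2)^{1/2}$; $\mathbb{B}_{\ell_2^n}=\{z\in\mathbb{C}^n:\|z\|_2<1\}$; $\mathbb{D}$ is the open unit disc in $\mathbb{C}$. Multi-indices consist of nonnegative integers and $|m|=\sum_j m_j$. A twice continuously differentiable complex-valued function $f$ on a domain $\Omega\subset\mathbb{C}^n$ is pluriharmonic if for each fixed $z\in\Omega$ and $\theta\in\mathbb{C}^n$ with $\|\theta\|_2=1$, the function $\zeta\mapsto f(z+\zeta\theta)$ is harmonic in $\{\zeta\in\mathbb{C}:|\zeta|<d_\Omega(z)\}$, where $d_\Omega(z)$ is the Euclidean distance from $z$ to $\partial\Omega$ (for $n=1$ these are the planar harmonic functions). Derivatives are Wirtinger derivatives. *)

theory Defs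
  imports "HOL-Analysis.Analysis"
begin

text \<open>Twice continuous differentiability is meant over the reals; \<open>S\<close> is an open set.\<close>

definition C2_on :: "'a::real_normed_vector set \<Rightarrow> ('a \<Rightarrow> 'b::real_normed_vector) \<Rightarrow> bool"
  where "C2_on S f \<longleftrightarrow>
    (\<exists>(f' :: 'a \<Rightarrow> 'a \<Rightarrow>\<^sub>L 'b) (f'' :: 'a \<Rightarrow> 'a \<Rightarrow>\<^sub>L 'a \<Rightarrow>\<^sub>L 'b).
       (\<forall>x\<in>S. (f has_derivative blinfun_apply (f' x)) (at x)) \<and>
       (\<forall>x\<in>S. (f' has_derivative blinfun_apply (f'' x)) (at x)) \<and>
       continuous_on S f'')"

definition dir_deriv :: "'a::real_normed_vector \<Rightarrow> ('a \<Rightarrow> 'b::real_normed_vector) \<Rightarrow> 'a \<Rightarrow> 'b"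
  where "dir_deriv v f x = vector_derivative (\<lambda>t::real. f (x + t *\<^sub>R v)) (at 0)"

text \<open>With \<open>\<zeta> = x + \<i> y\<close>, the Laplacian is \<open>\<partial>\<^sup>2/\<partial>x\<^sup>2 + \<partial>\<^sup>2/\<partial>y\<^sup>2\<close>.\<close>

definition harmonic_on :: "complex set \<Rightarrow> (complex \<Rightarrow> complex) \<Rightarrow> bool"
  where "harmonic_on U g \<longleftrightarrow> C2_on U g \<and>
    (\<forall>\<zeta>\<in>U. dir_deriv 1 (dir_deriv 1 g) \<zeta> + dir_deriv \<i> (dir_deriv \<i> g) \<zeta> = 0)"

text \<open>Extended-real valued, so that the distance to an empty boundary is \<open>\<infinity>\<close>.\<close>

definition boundary_dist :: "'a::metric_space set \<Rightarrow> 'a \<Rightarrow> ereal"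
  where "boundary_dist S z = (INF w\<in>frontier S. ereal (dist z w))"

text \<open>The norm on \<^typ>\<open>complex ^ 'n\<close> is the Euclidean norm, and \<open>*s\<close> is multiplication by a
  complex scalar.\<close>

definition pluriharmonic_on :: "(complex ^ 'n) set \<Rightarrow> (complex ^ 'n \<Rightarrow> complex) \<Rightarrow> bool"
  where "pluriharmonic_on S f \<longleftrightarrow> C2_on S f \<and>
    (\<forall>z\<in>S. \<forall>\<theta>. norm \<theta> = 1 \<longrightarrow>
       harmonic_on {\<zeta>. ereal (norm \<zeta>) < boundary_dist S z} (\<lambda>\<zeta>. f (z + \<zeta> *s \<theta>)))"

text \<open>The Wirtinger derivatives with respect to \<open>z\<^sub>j\<close> and to its conjugate; the vectors
  \<^term>\<open>axis j 1\<close> and \<^term>\<open>axis j \<i>\<close> are the real directions \<open>x\<^sub>j\<close> and \<open>y\<^sub>j\<close>.\<close>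

definition wirtinger :: "'n::finite \<Rightarrow> (complex ^ 'n \<Rightarrow> complex) \<Rightarrow> complex ^ 'n \<Rightarrow> complex"
  where "wirtinger j f z = (dir_deriv (axis j 1) f z - \<i> * dir_deriv (axis j \<i>) f z) / 2"

definition wirtinger_bar :: "'n::finite \<Rightarrow> (complex ^ 'n \<Rightarrow> complex) \<Rightarrow> complex ^ 'n \<Rightarrow> complex"
  where "wirtinger_bar j f z = (dir_deriv (axis j 1) f z + \<i> * dir_deriv (axis j \<i>) f z) / 2"

text \<open>\<open>D\<^sub>1\<^bsup>m\<^sub>1\<^esup> (\<dots> (D\<^sub>n\<^bsup>m\<^sub>n\<^esup> f))\<close> for a family \<open>D\<close> of partial derivative operators.
  The linear order on the finite index type only fixes the order in which the operators,
  which need not commute on arbitrary functions, are applied.\<close>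

definition multi_deriv ::
    "('n::{finite,linorder} \<Rightarrow> (complex ^ 'n::{finite,linorder} \<Rightarrow> complex) \<Rightarrow> complex ^ 'n::{finite,linorder} \<Rightarrow> complex)
      \<Rightarrow> ('n::{finite,linorder} \<Rightarrow> nat) \<Rightarrow> (complex ^ 'n::{finite,linorder} \<Rightarrow> complex) \<Rightarrow> complex ^ 'n::{finite,linorder} \<Rightarrow> complex"
  where "multi_deriv D m f = foldr (\<lambda>j. D j ^^ m j) (sorted_list_of_set UNIV) f"

definition multi_order :: "('n::finite \<Rightarrow> nat) \<Rightarrow> nat"
  where "multi_order m = (\<Sum>j\<in>UNIV. m j)"

end

theory Submission
  imports Defs "HOL-Complex_Analysis.Complex_Analysis"
    "HOL-Combinatorics.Multiset_Permutations" "HOL-Library.Real_Mod"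
begin

text \<open>Write \<open>f = h + cnj g\<close> with \<open>h\<close> and \<open>g\<close> holomorphic; the two derivatives in the theorem are those of
\<open>h\<close> and, up to conjugation, of \<open>g\<close>.

On the disc, the Taylor coefficients at \<open>0\<close> satisfy \<open>\<bar>a\<^sub>k\<bar> + \<bar>b\<^sub>k\<bar> \<le> 4/\<pi>\<close>: after a rotation the sum is
the integral of \<open>f\<close> against a multiple of \<open>sin (k t)\<close>, and \<open>\<bar>sin (k t)\<bar>\<close> has integral \<open>4\<close> over the
circle (\<open>coeff_bound\<close>). For a general centre \<open>z\<close>, precompose with the Moebius automorphism
taking \<open>0\<close> to \<open>z\<close>: the \<open>m\<close>-th derivative at \<open>z\<close> becomes a combination of the first \<open>m\<close> coefficients
at \<open>0\<close> whose weights add up binomially to \<open>(1 + \<bar>z\<bar>)^(m-1) / (1 - \<bar>z\<bar>\<^sup>2)^m\<close>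
(\<open>disc_derivative_bound\<close>). Equality at \<open>z = 0\<close> holds for
\<open>(2/\<pi>) arg ((1 + z^m) / (1 - z^m))\<close>, so the constant is sharp.

In several variables, harmonicity on complex lines says that the Levi form of \<open>f\<close> vanishes. This
makes every first derivative \<open>\<partial>\<^sub>j f\<close> holomorphic and makes the restriction of \<open>f\<close> to a complex line
again a sum \<open>h + cnj g\<close>. A line through \<open>z\<close> in direction \<open>\<theta>\<close> meets the ball in a disc, and the estimate
on the disc gives, with \<open>M = \<bar>m\<bar>\<close>,
\<open>4/\<pi> M! \<parallel>\<theta>\<parallel> (\<parallel>\<theta>\<parallel> + \<bar>\<langle>z,\<theta>\<rangle>\<bar>)^(M-1) / (1 - \<parallel>z\<parallel>\<^sup>2)^M\<close> as a bound for the sum of the moduli of the \<open>M\<close>-fold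
derivatives of \<open>h\<close> and \<open>g\<close> in direction \<open>\<theta>\<close> (\<open>direction_derivative_bound\<close>).

The \<open>M\<close>-fold derivative in direction \<open>\<theta>\<close> is a homogeneous polynomial in \<open>\<theta>\<close> whose coefficient at
\<open>\<theta>^m\<close> is \<open>M!/m!\<close> times the wanted mixed derivative. Averaging over a torus \<open>\<bar>\<theta>\<^sub>j\<bar> = r\<^sub>j\<close> extracts it
(\<open>coefficient_bound_from_torus\<close>). The choice \<open>r\<^sub>j = m\<^sub>j / (1 + \<bar>z\<^sub>j\<bar>)\<close> is what produces the product
\<open>\<Prod>(1 + \<bar>z\<^sub>j\<bar>)^m\<^sub>j\<close>, because \<open>\<parallel>\<theta>\<parallel> + \<bar>\<langle>z,\<theta>\<rangle>\<bar> \<le> \<Sum> r\<^sub>j (1 + \<bar>z\<^sub>j\<bar>) = M\<close>. What remains is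
\<open>m! M^M / m^m \<le> M! (n+M-1 choose n-1)\<close>: among the \<open>(n+M-1 choose n-1)\<close> terms of the multinomial
expansion of \<open>(m\<^sub>1 + \<dots> + m\<^sub>n)^M\<close>, the one with exponent \<open>m\<close> is the largest
(\<open>power_sum_div_fact_le\<close>, \<open>power_div_fact_le_diagonal\<close>).\<close>

section \<open>Harmonic functions on the unit disc\<close>

text \<open>Each half period of length \<open>\<pi>/k\<close> contributes \<open>2/k\<close>.\<close>

lemma has_integral_abs_sin_pieces:
  assumes "k \<ge> (1::nat)"
  shows "((\<lambda>t::real. \<bar>sin (real k * t)\<bar>) has_integral 2 * real n / real k) {0..real n * pi / real k}"
proof (induction n)
  case 0
  have "((\<lambda>t::real. \<bar>sin (real k * t)\<bar>) has_integral 0) (cbox 0 0)"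
    by (rule has_integral_refl)
  then show ?case by simp
next
  case (Suc n)
  have kp: "real k > 0" using assms by simp
  let ?a = "real n * pi / real k" and ?b = "real (Suc n) * pi / real k"
  have ab: "?a \<le> ?b" using kp by (simp add: divide_right_mono)
  have "((\<lambda>t. (-1)^n * sin (real k * t)) has_integral
      (- ((-1)^n * cos (real k * ?b) / real k)) - (- ((-1)^n * cos (real k * ?a) / real k))) {?a..?b}"
    using ab kp by (intro fundamental_theorem_of_calculus)
      (auto intro!: derivative_eq_intros simp: has_real_derivative_iff_has_vector_derivative[symmetric])
  also have "(- ((-1)^n * cos (real k * ?b) / real k)) - (- ((-1)^n * cos (real k * ?a) / real k))
     = 2 / real k"
  proof -
    have "real k * ?b = real n * pi + pi" "real k * ?a = real n * pi"
      using kp by (auto simp: field_simps)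
    then have "cos (real k * ?b) = - ((-1)^n)" "cos (real k * ?a) = (-1)^n"
      by (simp_all only: cos_periodic_pi cos_npi)
    moreover have "(-1)^n * (-1)^n = (1::real)" by (simp flip: power_mult_distrib)
    ultimately show ?thesis using kp by (simp add: field_simps)
  qed
  finally have 1: "((\<lambda>t. (-1)^n * sin (real k * t)) has_integral 2 / real k) {?a..?b}" .
  have "((\<lambda>t. \<bar>sin (real k * t)\<bar>) has_integral 2 / real k) {?a..?b}"
  proof (rule has_integral_eq[OF _ 1])
    fix t assume t: "t \<in> {?a..?b}"
    define v where "v = real k * t - real n * pi"
    have "v \<ge> 0" "v \<le> pi"
      using t kp by (auto simp: v_def field_simps)
    then have "sin v \<ge> 0" by (rule sin_ge_zero)
    moreover have "sin (real k * t) = (-1)^n * sin v"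
    proof -
      have "real k * t = v + real n * pi" by (simp add: v_def)
      then show ?thesis by (simp add: sin_add)
    qed
    ultimately show "(-1)^n * sin (real k * t) = \<bar>sin (real k * t)\<bar>"
      by (simp add: abs_mult flip: power_add mult.assoc power_mult_distrib)
  qed
  moreover have "0 \<le> ?a" using kp by simp
  ultimately have "((\<lambda>t. \<bar>sin (real k * t)\<bar>) has_integral (2 * real n / real k + 2 / real k)) {0..?b}"
    using has_integral_combine[OF _ ab Suc.IH] by blast
  then show ?case by (simp add: add_divide_distrib distrib_left add.commute)
qed

lemma has_integral_abs_sin:
  assumes "k \<ge> (1::nat)"
  shows "((\<lambda>t::real. \<bar>sin (real k * t)\<bar>) has_integral 4) {0..2*pi}"
  using has_integral_abs_sin_pieces[OF assms, of "2*k"] assms by simp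

text \<open>Cauchy's formula on a circle, written as the extraction of a Fourier coefficient.\<close>

lemma has_integral_circle_coeff:
  assumes "h holomorphic_on ball 0 1" "0 < r" "r < 1"
  shows "((\<lambda>t. h (of_real r * cis t) * cis (- (real k * t))) has_integral
           of_real (2 * pi * r ^ k) * ((deriv ^^ k) h 0 / fact k)) {0..2*pi}"
proof -
  have "continuous_on (cball 0 r) h"
    using assms by (intro holomorphic_on_imp_continuous_on holomorphic_on_subset[OF assms(1)]) auto
  moreover have "h holomorphic_on ball 0 r"
    using assms by (intro holomorphic_on_subset[OF assms(1)]) auto
  ultimately have "((\<lambda>u. h u / (u - 0) ^ Suc k) has_contour_integral
        (2 * pi * \<i>) / fact k * (deriv ^^ k) h 0) (circlepath 0 r)"
    using assms by (intro Cauchy_has_contour_integral_higher_derivative_circlepath) auto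
  then have "((\<lambda>t. h (of_real r * cis t) / (of_real r * cis t) ^ Suc k * of_real r * \<i> * cis t) has_integral
        (2 * pi * \<i>) / fact k * (deriv ^^ k) h 0) {0..2*pi}"
    unfolding circlepath_def by (subst (asm) has_contour_integral_part_circlepath_iff) auto
  then have "((\<lambda>t. (of_real (r^k) / \<i>) * (h (of_real r * cis t) / (of_real r * cis t) ^ Suc k * of_real r * \<i> * cis t)) has_integral
        (of_real (r^k) / \<i>) * ((2 * pi * \<i>) / fact k * (deriv ^^ k) h 0)) {0..2*pi}"
    by (rule has_integral_mult_right)
  moreover have "(of_real (r^k) / \<i>) * (h (of_real r * cis t) / (of_real r * cis t) ^ Suc k * of_real r * \<i> * cis t)
      = h (of_real r * cis t) * cis (- (real k * t))" for t
  proof -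
    have "cis (- (real k * t)) = inverse (cis t ^ k)"
      by (simp add: Complex.DeMoivre cis_inverse)
    then show ?thesis
      using assms by (simp add: field_simps power_mult_distrib)
  qed
  moreover have "(of_real (r^k) / \<i>) * ((2 * pi * \<i>) / fact k * (deriv ^^ k) h 0)
      = of_real (2 * pi * r ^ k) * ((deriv ^^ k) h 0 / fact k)"
    by (simp add: field_simps)
  ultimately show ?thesis by (simp only:)
qed

text \<open>A holomorphic function has no negative frequencies, so conjugate-holomorphic functions do not
contribute to the positive ones.\<close>

lemma has_integral_circle_coeff_neg:
  assumes "h holomorphic_on ball 0 1" "0 < r" "r < 1" "k \<ge> 1"
  shows "((\<lambda>t. h (of_real r * cis t) * cis (real k * t)) has_integral 0) {0..2*pi}"
proof -
  have "((\<lambda>u. h u * u ^ (k-1)) has_contour_integral 0) (circlepath 0 r)"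
    by (rule Cauchy_theorem_disc_simple[of _ 0 1])
      (use assms in \<open>auto intro!: holomorphic_intros\<close>)
  then have "((\<lambda>t. h (of_real r * cis t) * (of_real r * cis t) ^ (k-1) * of_real r * \<i> * cis t) has_integral 0) {0..2*pi}"
    unfolding circlepath_def by (subst (asm) has_contour_integral_part_circlepath_iff) auto
  then have "((\<lambda>t. 1 / (of_real (r^k) * \<i>) * (h (of_real r * cis t) * (of_real r * cis t) ^ (k-1) * of_real r * \<i> * cis t)) has_integral
      1 / (of_real (r^k) * \<i>) * 0) {0..2*pi}"
    by (rule has_integral_mult_right)
  moreover have "1 / (of_real (r^k) * \<i>) * (h (of_real r * cis t) * (of_real r * cis t) ^ (k-1) * of_real r * \<i> * cis t)
    = h (of_real r * cis t) * cis (real k * t)" for t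
  proof -
    obtain k' where k: "k = Suc k'" using assms(4) by (cases k) auto
    have "cis (real k * t) = cis t ^ k" by (simp only: Complex.DeMoivre)
    then show ?thesis using assms k by (simp add: field_simps power_mult_distrib)
  qed
  ultimately show ?thesis by (simp only: mult_zero_right)
qed

text \<open>Integrate \<open>h + cnj g\<close> against \<open>cis (- k t) - cis (k t) = - 2 \<i> sin (k t)\<close>: the first summand picks the
coefficient of \<open>h\<close>, the second that of \<open>cnj g\<close>.\<close>

lemma coeff_bound_aligned:
  assumes h: "h holomorphic_on ball 0 1" and g: "g holomorphic_on ball 0 1"
    and bd: "\<And>\<zeta>. norm \<zeta> < 1 \<Longrightarrow> norm (h \<zeta> + cnj (g \<zeta>)) \<le> 1"
    and k: "k \<ge> 1"
  shows "norm ((deriv ^^ k) h 0 - cnj ((deriv ^^ k) g 0)) \<le> 4 / pi * fact k"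
proof -
  define a where "a = (deriv ^^ k) h 0 / fact k"
  define b where "b = (deriv ^^ k) g 0 / fact k"
  have *: "norm (a - cnj b) * r ^ k \<le> 4 / pi" if r: "0 < r" "r < 1" for r
  proof -
    let ?z = "\<lambda>t. of_real r * cis t"
    let ?e = "\<lambda>t. cis (- (real k * t))" and ?e' = "\<lambda>t. cis (real k * t)"
    have h1: "((\<lambda>t. h (?z t) * ?e t) has_integral of_real (2 * pi * r ^ k) * a) {0..2*pi}"
      unfolding a_def by (rule has_integral_circle_coeff[OF h r])
    have h2: "((\<lambda>t. h (?z t) * ?e' t) has_integral 0) {0..2*pi}"
      by (rule has_integral_circle_coeff_neg[OF h r k])
    have g1: "((\<lambda>t. cnj (g (?z t) * ?e t)) has_integral cnj (of_real (2 * pi * r ^ k) * b)) {0..2*pi}"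
      unfolding b_def
      by (rule has_integral_cnj[THEN iffD2, OF has_integral_circle_coeff[OF g r], unfolded o_def])
    have g2: "((\<lambda>t. cnj (g (?z t) * ?e' t)) has_integral cnj 0) {0..2*pi}"
      by (rule has_integral_cnj[THEN iffD2, OF has_integral_circle_coeff_neg[OF g r k], unfolded o_def])
    have "((\<lambda>t. (h (?z t) * ?e t - h (?z t) * ?e' t) + (cnj (g (?z t) * ?e' t) - cnj (g (?z t) * ?e t))) has_integral
        (of_real (2 * pi * r ^ k) * a - 0) + (cnj 0 - cnj (of_real (2 * pi * r ^ k) * b))) {0..2*pi}"
      by (intro has_integral_add has_integral_diff h1 h2 g1 g2)
    moreover have "(h (?z t) * ?e t - h (?z t) * ?e' t) + (cnj (g (?z t) * ?e' t) - cnj (g (?z t) * ?e t))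
        = (h (?z t) + cnj (g (?z t))) * (?e t - ?e' t)" for t
      by (simp add: cis_cnj algebra_simps)
    moreover have "(of_real (2 * pi * r ^ k) * a - 0) + (cnj 0 - cnj (of_real (2 * pi * r ^ k) * b))
        = of_real (2 * pi * r ^ k) * (a - cnj b)"
      by (simp add: algebra_simps)
    ultimately have I: "((\<lambda>t. (h (?z t) + cnj (g (?z t))) * (?e t - ?e' t)) has_integral
        of_real (2 * pi * r ^ k) * (a - cnj b)) {0..2*pi}"
      by (simp only:)
    have J: "((\<lambda>t. 2 * \<bar>sin (real k * t)\<bar>) has_integral 2 * 4) {0..2*pi}"
      by (rule has_integral_mult_right[OF has_integral_abs_sin[OF k]])
    have "norm (of_real (2 * pi * r ^ k) * (a - cnj b)) \<le> 8"
    proof -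
      have le: "norm ((h (?z t) + cnj (g (?z t))) * (?e t - ?e' t)) \<le> 2 * \<bar>sin (real k * t)\<bar>" for t
      proof -
        have "?e t - ?e' t = - (2 * \<i> * of_real (sin (real k * t)))"
          by (simp add: complex_eq_iff)
        then have "norm (?e t - ?e' t) = 2 * \<bar>sin (real k * t)\<bar>"
          by (simp add: norm_mult)
        moreover have "norm (h (?z t) + cnj (g (?z t))) \<le> 1"
          using r by (intro bd) (simp add: norm_mult)
        ultimately show ?thesis by (simp add: norm_mult mult_left_le_one_le)
      qed
      have "norm (integral {0..2*pi} (\<lambda>t. (h (?z t) + cnj (g (?z t))) * (?e t - ?e' t)))
          \<le> integral {0..2*pi} (\<lambda>t. 2 * \<bar>sin (real k * t)\<bar>)"
        using I J le by (intro integral_norm_bound_integral) (auto simp: integrable_on_def)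
      then show ?thesis unfolding integral_unique[OF I] integral_unique[OF J] by simp
    qed
    then have "(2 * pi * r ^ k) * norm (a - cnj b) \<le> 8"
      using r unfolding norm_mult norm_of_real by simp
    then show ?thesis by (simp add: field_simps)
  qed
  have "norm (a - cnj b) * 1 ^ k \<le> 4 / pi"
  proof (rule tendsto_upperbound)
    show "((\<lambda>r. norm (a - cnj b) * r ^ k) \<longlongrightarrow> norm (a - cnj b) * 1 ^ k) (at_left (1::real))"
      by (intro tendsto_intros)
    show "\<forall>\<^sub>F r in at_left (1::real). norm (a - cnj b) * r ^ k \<le> 4 / pi"
      unfolding eventually_at_left_field by (rule exI[of _ 0]) (auto intro: *)
  qed simp
  moreover have "(deriv ^^ k) h 0 - cnj ((deriv ^^ k) g 0) = of_real (fact k) * (a - cnj b)"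
    by (simp add: a_def b_def right_diff_distrib)
  then have "norm ((deriv ^^ k) h 0 - cnj ((deriv ^^ k) g 0)) = fact k * norm (a - cnj b)"
    by (simp only: norm_mult norm_of_real) simp
  ultimately show ?thesis using mult_left_mono[of "norm (a - cnj b)" "4 / pi" "fact k"]
    by (simp add: mult.commute)
qed

text \<open>Replacing \<open>\<zeta>\<close> by \<open>u \<zeta>\<close> with \<open>\<bar>u\<bar> = 1\<close> turns the arguments of the two coefficients in opposite directions,
so they can be brought into opposition; then the modulus of their difference is the sum of moduli.\<close>

lemma coeff_bound:
  assumes h: "h holomorphic_on ball 0 1" and g: "g holomorphic_on ball 0 1"
    and bd: "\<And>\<zeta>. norm \<zeta> < 1 \<Longrightarrow> norm (h \<zeta> + cnj (g \<zeta>)) \<le> 1"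
    and k: "k \<ge> 1"
  shows "norm ((deriv ^^ k) h 0) + norm ((deriv ^^ k) g 0) \<le> 4 / pi * fact k"
proof -
  define A where "A = (deriv ^^ k) h 0"
  define B where "B = cnj ((deriv ^^ k) g 0)"
  \<comment> \<open>The angle for which \<open>u ^ k * A\<close> and \<open>cnj (u ^ k) * B\<close> point in opposite directions.\<close>
  define s where "s = (Arg B - Arg A - pi) / (2 * real k)"
  define u where "u = cis s"
  have u: "norm u = 1" by (simp add: u_def)
  have hol: "(\<lambda>\<zeta>. f (u * \<zeta>)) holomorphic_on ball 0 1" if "f holomorphic_on ball 0 1" for f
    using that u by (intro holomorphic_on_compose_gen[OF _ that, unfolded o_def])
      (auto intro!: holomorphic_intros simp: norm_mult)
  have der: "(deriv ^^ k) (\<lambda>\<zeta>. f (u * \<zeta>)) 0 = u ^ k * (deriv ^^ k) f 0" if "f holomorphic_on ball 0 1" for f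
    using higher_deriv_compose_linear[OF that, of "ball 0 1" 0 u k] u by (simp add: norm_mult)
  have "norm ((deriv ^^ k) (\<lambda>\<zeta>. h (u * \<zeta>)) 0 - cnj ((deriv ^^ k) (\<lambda>\<zeta>. g (u * \<zeta>)) 0)) \<le> 4 / pi * fact k"
    using u by (intro coeff_bound_aligned hol h g bd k) (auto simp: norm_mult)
  then have *: "norm (u ^ k * A - cnj (u ^ k) * B) \<le> 4 / pi * fact k"
    by (simp add: der h g A_def B_def)
  have A: "A = norm A * cis (Arg A)" and B: "B = norm B * cis (Arg B)"
    by (metis rcis_cmod_Arg rcis_def)+
  have uk: "u ^ k = cis (real k * s)" by (simp add: u_def Complex.DeMoivre)
  have "real k * s + Arg A = \<alpha> \<Longrightarrow> - (real k * s) + Arg B = \<alpha> + pi" for \<alpha>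
    using k by (auto simp: s_def field_simps)
  then obtain \<alpha> where \<alpha>: "real k * s + Arg A = \<alpha>" "- (real k * s) + Arg B = \<alpha> + pi" by blast
  have "u ^ k * A = norm A * cis \<alpha>"
    by (subst A) (simp add: uk cis_mult \<alpha>(1))
  moreover have "cnj (u ^ k) * B = - (norm B * cis \<alpha>)"
  proof -
    have "cis (- (real k * s)) * cis (Arg B) = - cis \<alpha>"
      by (simp only: cis_mult \<alpha>(2)) (simp add: complex_eq_iff)
    moreover have "cnj (u ^ k) * B = norm B * (cis (- (real k * s)) * cis (Arg B))"
      by (subst B) (simp only: uk cis_cnj mult_ac)
    ultimately show ?thesis by simp
  qed
  ultimately have "u ^ k * A - cnj (u ^ k) * B = of_real (norm A + norm B) * cis \<alpha>"
    by (simp add: algebra_simps)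
  then have "norm (u ^ k * A - cnj (u ^ k) * B) = norm A + norm B"
    by (simp only: norm_mult norm_of_real) simp
  with * show ?thesis by (simp add: A_def B_def)
qed

text \<open>With \<open>s = 1 - \<bar>z\<bar>\<^sup>2\<close>, the inverse of the automorphism is \<open>\<psi> w = (w/s) / (1 - (cnj z/s) w)\<close> in the variable
\<open>w = u - z\<close>. The formula is the composition rule for power series, \<open>\<psi>^k\<close> being expanded by the negative
binomial series.\<close>

lemma higher_deriv_moebius:
  assumes h: "h holomorphic_on ball 0 1" and z: "norm z < 1" and m: "m \<ge> 1"
  defines "H \<equiv> (\<lambda>\<zeta>. h ((\<zeta> + z) / (1 + cnj z * \<zeta>)))"
  shows "(deriv ^^ m) h z / fact m = (\<Sum>k=1..m. (of_nat ((m-1) choose (k-1)) * cnj z ^ (m-k)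
            / of_real ((1 - (norm z)^2) ^ m)) * ((deriv ^^ k) H 0 / fact k))"
proof -
  define s where "s = 1 - (norm z)^2"
  have s: "s > 0" using z by (simp add: s_def power_less_one_iff)
  have sz: "of_real s = 1 - z * cnj z" by (simp add: s_def complex_norm_square[symmetric])
  define c where "c = cnj z / of_real s"
  define \<psi> where "\<psi> = (\<lambda>w. of_real (1 / s) * (w * inverse (1 - c * w)))"
  define G where "G = fps_const (of_real (1 / s)) * (fps_X * inverse (1 - fps_const c * fps_X))"
  have \<psi>: "\<psi> has_fps_expansion G"
    unfolding \<psi>_def G_def by (intro fps_expansion_intros) auto
  have G0: "fps_nth G 0 = 0" by (simp add: G_def)
  have "(\<lambda>\<zeta>. Moebius_function 0 (-z) \<zeta>) holomorphic_on ball 0 1"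
    using z by (intro Moebius_function_holomorphic) auto
  then have "h \<circ> Moebius_function 0 (-z) holomorphic_on ball 0 1"
    by (rule holomorphic_on_compose_gen[OF _ h]) (use z Moebius_function_norm_lt_1 in auto)
  then have H: "H has_fps_expansion fps_expansion H 0"
    by (intro has_fps_expansion_fps_expansion[of "ball 0 1"])
      (auto simp: H_def Moebius_function_def o_def)
  have comp: "(H \<circ> \<psi>) has_fps_expansion fps_compose (fps_expansion H 0) G"
    by (intro has_fps_expansion_compose H \<psi> G0)
  have ev: "\<forall>\<^sub>F w in nhds 0. (H \<circ> \<psi>) w = h (z + w)"
  proof -
    have "isCont (\<lambda>w. 1 - c * w) 0" by (intro continuous_intros)
    then have "((\<lambda>w. 1 - c * w) \<longlongrightarrow> 1) (nhds 0)"
      by (simp add: isCont_def tendsto_nhds_iff)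
    then have "\<forall>\<^sub>F w in nhds 0. 1 - c * w \<noteq> 0"
      by (rule tendsto_imp_eventually_ne) simp
    then show ?thesis
    proof eventually_elim
      case (elim w)
      have snz: "complex_of_real s \<noteq> 0" using s by simp
      have sc: "of_real s * c = cnj z" using s by (simp add: c_def)
      define d where "d = of_real s * (1 - c * w)"
      have d: "d = of_real s - cnj z * w" by (simp add: d_def algebra_simps flip: sc)
      have dnz: "d \<noteq> 0" using elim snz by (simp add: d_def)
      have \<psi>w: "\<psi> w = w / d" using elim snz by (simp add: \<psi>_def d_def field_simps)
      have "1 + cnj z * \<psi> w = of_real s / d"
        using dnz by (simp add: \<psi>w field_simps) (simp add: d)
      moreover have "\<psi> w + z = (of_real s * (z + w)) / d"
        using dnz by (simp add: \<psi>w field_simps) (simp add: d sz algebra_simps)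
      ultimately have "(\<psi> w + z) / (1 + cnj z * \<psi> w) = z + w"
        using snz dnz by simp
      then show ?case by (simp add: H_def)
    qed
  qed
  have "(deriv ^^ m) (\<lambda>w. h (z + w)) 0 / fact m = (deriv ^^ m) (H \<circ> \<psi>) 0 / fact m"
    by (rule arg_cong[where f="\<lambda>x. x / fact m"], rule sym, rule higher_deriv_cong_ev[OF ev refl])
  also have "\<dots> = fps_nth (fps_compose (fps_expansion H 0) G) m"
    using fps_nth_fps_expansion[OF comp] by simp
  also have "\<dots> = (\<Sum>i=0..m. fps_nth (fps_expansion H 0) i * fps_nth (G ^ i) m)"
    by (rule fps_compose_nth)
  also have "\<dots> = (\<Sum>i=1..m. fps_nth (fps_expansion H 0) i * fps_nth (G ^ i) m)"
    using m by (intro sum.mono_neutral_right) (auto simp: not_le intro!: gr0I)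
  also have "\<dots> = (\<Sum>k=1..m. (of_nat ((m-1) choose (k-1)) * cnj z ^ (m-k)
            / of_real (s ^ m)) * ((deriv ^^ k) H 0 / fact k))"
  proof (rule sum.cong[OF refl])
    fix i assume i: "i \<in> {1..m}"
    have "G ^ i = fps_const (of_real (1 / s) ^ i) * (fps_X ^ i * inverse ((1 - fps_const c * fps_X) ^ i))"
      by (simp add: G_def power_mult_distrib fps_inverse_power)
    also have "fps_nth \<dots> m = of_real (1 / s) ^ i * (of_nat ((i + (m - i) - 1) choose (m - i)) * c ^ (m - i))"
      using i by (subst one_minus_const_fps_X_neg_power') (auto simp: fps_X_power_mult_nth)
    also have "(i + (m - i) - 1) choose (m - i) = (m - 1) choose (i - 1)"
      using i by (subst binomial_symmetric) auto
    also have "of_real (1 / s) ^ i * (of_nat ((m - 1) choose (i - 1)) * c ^ (m - i))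
       = of_nat ((m-1) choose (i-1)) * cnj z ^ (m-i) / of_real (s ^ m)"
    proof -
      have "s ^ m = s ^ i * s ^ (m - i)" using i by (simp flip: power_add)
      then show ?thesis by (simp add: c_def power_divide)
    qed
    finally show "fps_nth (fps_expansion H 0) i * fps_nth (G ^ i) m = (of_nat ((m-1) choose (i-1)) * cnj z ^ (m-i)
            / of_real (s ^ m)) * ((deriv ^^ i) H 0 / fact i)"
      using fps_nth_fps_expansion[OF H, of i] by (simp only: mult_ac)
  qed
  also have "(deriv ^^ m) (\<lambda>w. h (z + w)) 0 = (deriv ^^ m) h z"
    by (simp add: higher_deriv_shift_0[of m h z] o_def)
  finally show ?thesis by (simp add: s_def)
qed

lemma disc_derivative_bound:
  assumes h: "h holomorphic_on ball 0 1" and g: "g holomorphic_on ball 0 1"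
    and bd: "\<And>\<zeta>. norm \<zeta> < 1 \<Longrightarrow> norm (h \<zeta> + cnj (g \<zeta>)) \<le> 1"
    and m: "m \<ge> 1" and z: "norm z < 1"
  shows "norm ((deriv ^^ m) h z) + norm ((deriv ^^ m) g z)
           \<le> 4 / pi * fact m * ((1 + norm z) ^ (m - 1) / (1 - (norm z)^2) ^ m)"
proof -
  let ?T = "\<lambda>f \<zeta>. f ((\<zeta> + z) / (1 + cnj z * \<zeta>))"
  define s where "s = 1 - (norm z)^2"
  have s: "s > 0" using z by (simp add: s_def power_less_one_iff)
  define W where "W = (\<lambda>k. real ((m-1) choose (k-1)) * norm z ^ (m-k) / s ^ m)"
  have hol: "?T f holomorphic_on ball 0 1" if "f holomorphic_on ball 0 1" for f
  proof -
    have "f \<circ> Moebius_function 0 (-z) holomorphic_on ball 0 1"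
      by (rule holomorphic_on_compose_gen[OF _ that])
        (use z Moebius_function_norm_lt_1 in \<open>auto intro!: Moebius_function_holomorphic\<close>)
    then show ?thesis by (simp add: Moebius_function_def o_def)
  qed
  have coeff: "norm ((deriv ^^ k) (?T h) 0) + norm ((deriv ^^ k) (?T g) 0) \<le> 4 / pi * fact k" if "k \<ge> 1" for k
  proof (intro coeff_bound hol h g that)
    fix \<zeta> :: complex assume "norm \<zeta> < 1"
    then have "norm ((\<zeta> + z) / (1 + cnj z * \<zeta>)) < 1"
      using Moebius_function_norm_lt_1[of "-z" \<zeta> 0] z by (simp add: Moebius_function_def)
    then show "norm (?T h \<zeta> + cnj (?T g \<zeta>)) \<le> 1" by (rule bd)
  qed
  have bnd: "norm ((deriv ^^ m) f z) / fact m \<le> (\<Sum>k=1..m. W k * (norm ((deriv ^^ k) (?T f) 0) / fact k))"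
    if f: "f holomorphic_on ball 0 1" for f
  proof -
    have "norm ((deriv ^^ m) f z) / fact m = norm ((deriv ^^ m) f z / fact m)"
      by (simp add: norm_divide)
    also have "\<dots> = norm (\<Sum>k=1..m. (of_nat ((m-1) choose (k-1)) * cnj z ^ (m-k)
            / of_real (s ^ m)) * ((deriv ^^ k) (?T f) 0 / fact k))"
      by (subst higher_deriv_moebius[OF f z m]) (simp add: s_def)
    also have "\<dots> \<le> (\<Sum>k=1..m. norm ((of_nat ((m-1) choose (k-1)) * cnj z ^ (m-k)
            / of_real (s ^ m)) * ((deriv ^^ k) (?T f) 0 / fact k)))"
      by (rule norm_sum)
    also have "\<dots> = (\<Sum>k=1..m. W k * (norm ((deriv ^^ k) (?T f) 0) / fact k))"
      using s by (intro sum.cong) (auto simp: W_def norm_mult norm_divide norm_power)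
    finally show ?thesis .
  qed
  have "norm ((deriv ^^ m) h z) / fact m + norm ((deriv ^^ m) g z) / fact m
     \<le> (\<Sum>k=1..m. W k * (norm ((deriv ^^ k) (?T h) 0) / fact k)) + (\<Sum>k=1..m. W k * (norm ((deriv ^^ k) (?T g) 0) / fact k))"
    by (intro add_mono bnd h g)
  also have "\<dots> = (\<Sum>k=1..m. W k * ((norm ((deriv ^^ k) (?T h) 0) + norm ((deriv ^^ k) (?T g) 0)) / fact k))"
    by (simp add: sum.distrib[symmetric] algebra_simps add_divide_distrib)
  also have "\<dots> \<le> (\<Sum>k=1..m. W k * (4 / pi))"
    using s coeff by (intro sum_mono mult_left_mono) (auto simp: W_def divide_simps)
  also have "(\<Sum>k=1..m. W k * (4 / pi)) = 4 / pi * ((\<Sum>k=1..m. real ((m-1) choose (k-1)) * norm z ^ (m-k)) / s ^ m)"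
    by (simp add: W_def sum_distrib_left sum_divide_distrib mult_ac)
  also have "(\<Sum>k=1..m. real ((m-1) choose (k-1)) * norm z ^ (m-k)) = (1 + norm z) ^ (m - 1)"
  proof -
    have "(\<Sum>k=1..m. real ((m-1) choose (k-1)) * norm z ^ (m-k)) = (\<Sum>k\<le>m-1. real ((m-1) choose k) * norm z ^ (m-1-k))"
      by (rule sum.reindex_bij_witness[of _ Suc "\<lambda>k. k - 1"]) (use m in auto)
    also have "\<dots> = (1 + norm z) ^ (m - 1)"
      by (simp add: binomial_ring)
    finally show ?thesis .
  qed
  finally show ?thesis by (simp add: s_def field_simps)
qed

section \<open>Symmetry of second derivatives\<close>

text \<open>The mean value inequality for \<open>s \<mapsto> f (x + t u + s t v) - f (x + s t v)\<close>, whose derivative is compared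
with \<open>t\<^sup>2 F u v\<close> by the differentiability of \<open>f'\<close> at the single point \<open>x\<close>.\<close>

lemma second_difference_estimate:
  fixes f :: "'a::real_normed_vector \<Rightarrow> 'b::real_normed_vector"
    and f' :: "'a \<Rightarrow> 'a \<Rightarrow>\<^sub>L 'b" and F :: "'a \<Rightarrow>\<^sub>L 'a \<Rightarrow>\<^sub>L 'b"
  assumes S: "open S" "x \<in> S"
    and f': "\<And>y. y \<in> S \<Longrightarrow> (f has_derivative blinfun_apply (f' y)) (at y)"
    and F: "(f' has_derivative blinfun_apply F) (at x)"
    and e: "e > 0"
  shows "\<exists>d>0. \<forall>t. 0 < t \<longrightarrow> t < d \<longrightarrow>
    norm (f (x + t *\<^sub>R u + t *\<^sub>R v) - f (x + t *\<^sub>R u) - f (x + t *\<^sub>R v) + f x - t\<^sup>2 *\<^sub>R F u v)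
      \<le> t\<^sup>2 * (2 * e * (norm u + norm v) * norm v)"
proof -
  define K where "K = norm u + norm v"
  have K: "K \<ge> 0" by (simp add: K_def)
  obtain d0 where d0: "d0 > 0" "\<And>y. norm (y - x) < d0 \<Longrightarrow> norm (f' y - f' x - F (y - x)) \<le> e * norm (y - x)"
    using F e unfolding has_derivative_at_alt by blast
  obtain r where r: "r > 0" "ball x r \<subseteq> S" using S by (meson open_contains_ball)
  define d where "d = min d0 r / (K + 1)"
  have d: "d > 0" using d0 r K by (simp add: d_def)
  show ?thesis
  proof (intro exI[of _ d] conjI d allI impI)
    fix t :: real assume t: "0 < t" "t < d"
    have tK: "t * K < min d0 r"
    proof -
      have "t * K \<le> t * (K + 1)" using t by (intro mult_left_mono) auto
      also have "\<dots> < d * (K + 1)" using t K by (intro mult_strict_right_mono) auto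
      also have "\<dots> = min d0 r" using K by (simp add: d_def)
      finally show ?thesis .
    qed
    have small: "norm w < d0" "x + w \<in> S" "norm (f' (x + w) - f' x - F w) \<le> e * (t * K)"
      if w: "norm w \<le> t * K" for w
    proof -
      show 1: "norm w < d0" using w tK by simp
      have "x + w \<in> ball x r" using w tK by (simp add: dist_norm)
      then show "x + w \<in> S" using r by blast
      have "norm (f' (x + w) - f' x - F w) \<le> e * norm w" using d0(2)[of "x + w"] 1 by simp
      also have "\<dots> \<le> e * (t * K)" using w e by (intro mult_left_mono) auto
      finally show "norm (f' (x + w) - f' x - F w) \<le> e * (t * K)" .
    qed
    define \<phi> where "\<phi> = (\<lambda>s::real. f (x + (t *\<^sub>R u + (s * t) *\<^sub>R v)) - f (x + (s * t) *\<^sub>R v) - s *\<^sub>R (t\<^sup>2 *\<^sub>R F u v))"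
    define \<phi>' where "\<phi>' = (\<lambda>s::real. f' (x + (t *\<^sub>R u + (s * t) *\<^sub>R v)) (t *\<^sub>R v) - f' (x + (s * t) *\<^sub>R v) (t *\<^sub>R v) - t\<^sup>2 *\<^sub>R F u v)"
    have wn: "norm (t *\<^sub>R u + (s * t) *\<^sub>R v) \<le> t * K" "norm ((s * t) *\<^sub>R v) \<le> t * K" if s: "s \<in> {0..1}" for s
    proof -
      have "norm (t *\<^sub>R u + (s * t) *\<^sub>R v) \<le> norm (t *\<^sub>R u) + norm ((s * t) *\<^sub>R v)" by (rule norm_triangle_ineq)
      also have "\<dots> \<le> t * norm u + t * norm v"
        using s t by (auto simp: abs_mult intro!: mult_right_mono mult_left_le_one_le)
      finally show "norm (t *\<^sub>R u + (s * t) *\<^sub>R v) \<le> t * K" by (simp add: K_def distrib_left)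
      have "norm ((s * t) *\<^sub>R v) \<le> t * norm v"
        using s t by (auto simp: abs_mult intro!: mult_right_mono mult_left_le_one_le)
      also have "\<dots> \<le> t * K" using t by (simp add: K_def)
      finally show "norm ((s * t) *\<^sub>R v) \<le> t * K" .
    qed
    have "norm (\<phi> 1 - \<phi> 0) \<le> t\<^sup>2 * (2 * e * K * norm v) * norm (1 - 0 :: real)"
    proof (rule differentiable_bound[where S = "{0..1}" and f' = "\<lambda>s h. h *\<^sub>R \<phi>' s"])
      fix s :: real assume s: "s \<in> {0..1}"
      have L1: "((\<lambda>s. x + (t *\<^sub>R u + (s * t) *\<^sub>R v)) has_derivative (\<lambda>h. h *\<^sub>R (t *\<^sub>R v))) (at s within {0..1})"
        and L2: "((\<lambda>s. x + (s * t) *\<^sub>R v) has_derivative (\<lambda>h. h *\<^sub>R (t *\<^sub>R v))) (at s within {0..1})"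
        by (auto intro!: derivative_eq_intros)
      have D1: "((\<lambda>s. f (x + (t *\<^sub>R u + (s * t) *\<^sub>R v))) has_derivative (\<lambda>h. f' (x + (t *\<^sub>R u + (s * t) *\<^sub>R v)) (h *\<^sub>R (t *\<^sub>R v)))) (at s within {0..1})"
        by (rule has_derivative_compose[OF L1 f'[OF small(2)[OF wn(1)[OF s]]]])
      have D2: "((\<lambda>s. f (x + (s * t) *\<^sub>R v)) has_derivative (\<lambda>h. f' (x + (s * t) *\<^sub>R v) (h *\<^sub>R (t *\<^sub>R v)))) (at s within {0..1})"
        by (rule has_derivative_compose[OF L2 f'[OF small(2)[OF wn(2)[OF s]]]])
      have D3: "((\<lambda>s. s *\<^sub>R (t\<^sup>2 *\<^sub>R F u v)) has_derivative (\<lambda>h. h *\<^sub>R (t\<^sup>2 *\<^sub>R F u v))) (at s within {0..1})"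
        by (auto intro!: derivative_eq_intros)
      show "(\<phi> has_derivative (\<lambda>h. h *\<^sub>R \<phi>' s)) (at s within {0..1})"
        unfolding \<phi>_def
        by (rule has_derivative_eq_rhs[OF has_derivative_diff[OF has_derivative_diff[OF D1 D2] D3]])
          (simp add: \<phi>'_def blinfun.scaleR_right algebra_simps)
      let ?w1 = "t *\<^sub>R u + (s * t) *\<^sub>R v" and ?w2 = "(s * t) *\<^sub>R v"
      have "\<phi>' s = blinfun_apply ((f' (x + ?w1) - f' x - F ?w1) - (f' (x + ?w2) - f' x - F ?w2)) (t *\<^sub>R v)"
        by (simp add: \<phi>'_def blinfun.diff_left blinfun.add_left blinfun.add_right blinfun.diff_right
            blinfun.scaleR_left blinfun.scaleR_right power2_eq_square algebra_simps)
      also have "norm \<dots> \<le> norm ((f' (x + ?w1) - f' x - F ?w1) - (f' (x + ?w2) - f' x - F ?w2)) * norm (t *\<^sub>R v)"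
        by (rule norm_blinfun)
      also have "\<dots> \<le> (e * (t * K) + e * (t * K)) * norm (t *\<^sub>R v)"
        by (intro mult_right_mono order_trans[OF norm_triangle_ineq4 add_mono] small(3) wn s) auto
      also have "\<dots> = t\<^sup>2 * (2 * e * K * norm v)" using t by (simp add: power2_eq_square algebra_simps)
      finally have "norm (\<phi>' s) \<le> t\<^sup>2 * (2 * e * K * norm v)" .
      then show "onorm (\<lambda>h. h *\<^sub>R \<phi>' s) \<le> t\<^sup>2 * (2 * e * K * norm v)"
        using K e t by (intro onorm_bound) (auto intro!: mult_left_mono simp: mult.commute)
    qed auto
    then show "norm (f (x + t *\<^sub>R u + t *\<^sub>R v) - f (x + t *\<^sub>R u) - f (x + t *\<^sub>R v) + f x - t\<^sup>2 *\<^sub>R F u v)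
      \<le> t\<^sup>2 * (2 * e * (norm u + norm v) * norm v)"
      by (simp add: \<phi>_def K_def algebra_simps)
  qed
qed

text \<open>The second difference is symmetric in \<open>u\<close> and \<open>v\<close>, hence so is its leading term.\<close>

lemma second_derivative_symmetric:
  fixes f :: "'a::real_normed_vector \<Rightarrow> 'b::real_normed_vector"
    and f' :: "'a \<Rightarrow> 'a \<Rightarrow>\<^sub>L 'b" and F :: "'a \<Rightarrow>\<^sub>L 'a \<Rightarrow>\<^sub>L 'b"
  assumes S: "open S" "x \<in> S"
    and f': "\<And>y. y \<in> S \<Longrightarrow> (f has_derivative blinfun_apply (f' y)) (at y)"
    and F: "(f' has_derivative blinfun_apply F) (at x)"
  shows "F u v = F v u"
proof -
  define K where "K = 2 * (norm u + norm v)\<^sup>2"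
  have K: "K \<ge> 0" by (simp add: K_def)
  have le: "norm (F u v - F v u) \<le> e * K" if e: "e > 0" for e
  proof -
    obtain d1 where d1: "d1 > 0" "\<And>t. 0 < t \<Longrightarrow> t < d1 \<Longrightarrow>
       norm (f (x + t *\<^sub>R u + t *\<^sub>R v) - f (x + t *\<^sub>R u) - f (x + t *\<^sub>R v) + f x - t\<^sup>2 *\<^sub>R F u v)
      \<le> t\<^sup>2 * (2 * e * (norm u + norm v) * norm v)"
      using second_difference_estimate[OF S f' F e, of u v] by blast
    obtain d2 where d2: "d2 > 0" "\<And>t. 0 < t \<Longrightarrow> t < d2 \<Longrightarrow>
       norm (f (x + t *\<^sub>R v + t *\<^sub>R u) - f (x + t *\<^sub>R v) - f (x + t *\<^sub>R u) + f x - t\<^sup>2 *\<^sub>R F v u)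
      \<le> t\<^sup>2 * (2 * e * (norm v + norm u) * norm u)"
      using second_difference_estimate[OF S f' F e, of v u] by blast
    define t where "t = min d1 d2 / 2"
    have t: "0 < t" "t < d1" "t < d2" using d1(1) d2(1) by (auto simp: t_def)
    let ?D = "f (x + t *\<^sub>R u + t *\<^sub>R v) - f (x + t *\<^sub>R u) - f (x + t *\<^sub>R v) + f x"
    have D2: "f (x + t *\<^sub>R v + t *\<^sub>R u) - f (x + t *\<^sub>R v) - f (x + t *\<^sub>R u) + f x = ?D"
      by (simp add: algebra_simps)
    have "t\<^sup>2 * norm (F u v - F v u) = norm ((?D - t\<^sup>2 *\<^sub>R F v u) - (?D - t\<^sup>2 *\<^sub>R F u v))"
      by (simp add: scaleR_diff_right[symmetric])
    also have "\<dots> \<le> t\<^sup>2 * (2 * e * (norm v + norm u) * norm u) + t\<^sup>2 * (2 * e * (norm u + norm v) * norm v)"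
      by (rule order_trans[OF norm_triangle_ineq4 add_mono[OF d2(2)[OF t(1,3), unfolded D2] d1(2)[OF t(1,2)]]])
    also have "\<dots> = t\<^sup>2 * (e * K)" by (simp add: K_def power2_eq_square algebra_simps)
    finally show ?thesis using t by simp
  qed
  have "norm (F u v - F v u) \<le> 0"
  proof (rule field_le_epsilon)
    fix e :: real assume e: "e > 0"
    have "norm (F u v - F v u) \<le> e / (K + 1) * K" using e K by (intro le) auto
    also have "\<dots> \<le> e" using e K by (simp add: field_simps)
    finally show "norm (F u v - F v u) \<le> 0 + e" by simp
  qed
  then show ?thesis by simp
qed

section \<open>Holomorphic functions of several variables\<close>

text \<open>The value on \<open>v\<close> of the complex-linear part of the real differential: a Wirtinger derivative in an
arbitrary direction.\<close>

definition cdir :: "complex ^ 'n \<Rightarrow> (complex ^ 'n \<Rightarrow> complex) \<Rightarrow> complex ^ 'n \<Rightarrow> complex"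
  where "cdir v f x = (dir_deriv v f x - \<i> * dir_deriv (\<i> *s v) f x) / 2"

text \<open>On an open set these are the holomorphic functions of several variables. Continuity of the derivative
is part of the definition because it allows differentiation under the integral sign.\<close>

definition complex_C1_on :: "(complex ^ 'n) set \<Rightarrow> (complex ^ 'n \<Rightarrow> complex) \<Rightarrow> bool"
  where "complex_C1_on S h \<longleftrightarrow> (\<exists>h' :: complex ^ 'n \<Rightarrow> (complex ^ 'n) \<Rightarrow>\<^sub>L complex.
    (\<forall>x\<in>S. (h has_derivative blinfun_apply (h' x)) (at x)) \<and> continuous_on S h' \<and>
    (\<forall>x\<in>S. \<forall>v. h' x (\<i> *s v) = \<i> * h' x v))"

lemma scaleR_vec_complex: "r *\<^sub>R (v :: complex ^ 'n) = of_real r *s v"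
  by (simp add: vec_eq_iff complex_eq_iff)

lemma norm_vscale: "norm (c *s (v :: complex ^ 'n)) = norm c * norm v"
  by (simp add: norm_vec_def norm_mult L2_set_right_distrib)

lemma bounded_linear_vscale_left: "bounded_linear (\<lambda>c. c *s (v :: complex ^ 'n))"
proof (rule bounded_linear_intro[where K = "norm v"])
qed (simp_all add: norm_vscale vector_sadd_rdistrib scaleR_vec_complex scaleR_conv_of_real)

lemma bounded_linear_vscale_right: "bounded_linear (\<lambda>v :: complex ^ 'n. c *s v)"
proof (rule bounded_linear_intro[where K = "norm c"])
qed (simp_all add: norm_vscale vector_add_ldistrib scaleR_vec_complex mult.commute)

lemma complex_homogeneous:
  fixes L :: "complex ^ 'n \<Rightarrow> complex"
  assumes "bounded_linear L" "\<And>v. L (\<i> *s v) = \<i> * L v"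
  shows "L (c *s v) = c * L v"
proof -
  interpret bounded_linear L by fact
  have "c *s v = Re c *\<^sub>R v + \<i> *s (Im c *\<^sub>R v)"
    by (simp add: vec_eq_iff complex_eq_iff)
  then have "L (c *s v) = Re c *\<^sub>R L v + \<i> * (Im c *\<^sub>R L v)"
    by (simp only: add assms(2) scaleR)
  then show ?thesis by (simp add: complex_eq_iff)
qed

lemma dir_deriv_eq:
  assumes "(f has_derivative f') (at x)"
  shows "dir_deriv v f x = f' v"
proof -
  have "((\<lambda>t::real. x + t *\<^sub>R v) has_derivative (\<lambda>h. h *\<^sub>R v)) (at 0)"
    by (auto intro!: derivative_eq_intros)
  from has_derivative_compose[OF this, of f f'] assms
  have "((\<lambda>t::real. f (x + t *\<^sub>R v)) has_derivative (\<lambda>h. f' (h *\<^sub>R v))) (at 0)" by simp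
  then have "((\<lambda>t::real. f (x + t *\<^sub>R v)) has_vector_derivative f' v) (at 0)"
    using linear_scale[OF has_derivative_linear[OF assms]] by (simp add: has_vector_derivative_def)
  then show ?thesis by (simp add: dir_deriv_def vector_derivative_at)
qed

lemma dir_deriv_cong:
  assumes "open S" "x \<in> S" "\<And>y. y \<in> S \<Longrightarrow> f y = g y"
  shows "dir_deriv v f x = dir_deriv v g x"
proof -
  have "((\<lambda>t::real. x + t *\<^sub>R v) \<longlongrightarrow> x + 0 *\<^sub>R v) (nhds 0)"
    by (intro tendsto_add tendsto_const tendsto_scaleR filterlim_ident)
  then have "\<forall>\<^sub>F t in nhds 0. x + t *\<^sub>R v \<in> S"
    using assms(1,2) by (auto dest: topological_tendstoD)
  then have "\<forall>\<^sub>F t in nhds (0::real). t \<in> UNIV \<longrightarrow> f (x + t *\<^sub>R v) = g (x + t *\<^sub>R v)"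
    by eventually_elim (simp add: assms(3))
  then show ?thesis unfolding dir_deriv_def by (intro vector_derivative_cong_eq) auto
qed

lemma cdir_eq:
  assumes "(f has_derivative f') (at x)"
  shows "cdir v f x = (f' v - \<i> * f' (\<i> *s v)) / 2"
  by (simp add: cdir_def dir_deriv_eq[OF assms])

lemma cdir_eq_complex:
  assumes "(h has_derivative h') (at x)" "h' (\<i> *s v) = \<i> * h' v"
  shows "cdir v h x = h' v"
  by (simp add: cdir_eq[OF assms(1)] assms(2))

lemma cdir_cong:
  assumes "open S" "x \<in> S" "\<And>y. y \<in> S \<Longrightarrow> f y = g y"
  shows "cdir v f x = cdir v g x"
  unfolding cdir_def using assms by (simp add: dir_deriv_cong[OF assms])

lemma has_derivative_cong_open:
  assumes "open S" "x \<in> S" "\<And>y. y \<in> S \<Longrightarrow> f y = g y" "(f has_derivative D) (at x)"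
  shows "(g has_derivative D) (at x)"
  by (rule has_derivative_transform_within_open[OF assms(4,1,2,3)])

lemma complex_C1_on_cong:
  assumes "open S" "complex_C1_on S h" "\<And>y. y \<in> S \<Longrightarrow> h y = k y"
  shows "complex_C1_on S k"
proof -
  obtain h' where h': "\<And>x. x \<in> S \<Longrightarrow> (h has_derivative blinfun_apply (h' x)) (at x)" "continuous_on S h'"
    "\<And>x v. x \<in> S \<Longrightarrow> h' x (\<i> *s v) = \<i> * h' x v"
    using assms(2) unfolding complex_C1_on_def by blast
  show ?thesis unfolding complex_C1_on_def
  proof (intro exI[of _ h'] conjI ballI allI h')
    fix x assume x: "x \<in> S"
    show "(k has_derivative blinfun_apply (h' x)) (at x)"
      by (rule has_derivative_cong_open[OF assms(1) x assms(3) h'(1)[OF x]])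
  qed
qed

lemma complex_C1_on_local:
  assumes "\<And>x. x \<in> S \<Longrightarrow> \<exists>U. open U \<and> x \<in> U \<and> complex_C1_on U h"
  shows "complex_C1_on S h"
proof -
  define h' where "h' = (\<lambda>x. Blinfun (frechet_derivative h (at x)))"
  have loc: "\<exists>U. open U \<and> x \<in> U \<and> (\<forall>y\<in>U. (h has_derivative blinfun_apply (h' y)) (at y)) \<and> continuous_on U h' \<and>
    (\<forall>y\<in>U. \<forall>v. h' y (\<i> *s v) = \<i> * h' y v)" if "x \<in> S" for x
  proof -
    obtain U k where U: "open U" "x \<in> U" "\<forall>y\<in>U. (h has_derivative blinfun_apply (k y)) (at y)" "continuous_on U k"
      "\<forall>y\<in>U. \<forall>v. k y (\<i> *s v) = \<i> * k y v"
      using assms[OF \<open>x \<in> S\<close>] unfolding complex_C1_on_def by blast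
    have "h' y = k y" if "y \<in> U" for y
      unfolding h'_def frechet_derivative_at[OF U(3)[rule_format, OF that], symmetric]
      by (rule blinfun_apply_inverse)
    then show ?thesis using U by (intro exI[of _ U]) (auto cong: continuous_on_cong)
  qed
  have "continuous_on S h'"
    unfolding continuous_on_eq_continuous_within
  proof
    fix x assume "x \<in> S"
    then obtain U where "open U" "x \<in> U" "continuous_on U h'" using loc by blast
    then have "continuous (at x) h'" by (simp add: continuous_on_eq_continuous_at)
    then show "continuous (at x within S) h'" by (rule continuous_at_imp_continuous_at_within)
  qed
  then show ?thesis unfolding complex_C1_on_def using loc by blast
qed

lemma complex_C1_on_cmult:
  assumes "complex_C1_on S h"
  shows "complex_C1_on S (\<lambda>x. c * h x)"
proof -
  obtain h' where h': "\<forall>x\<in>S. (h has_derivative blinfun_apply (h' x)) (at x)" "continuous_on S h'"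
    "\<forall>x\<in>S. \<forall>v. h' x (\<i> *s v) = \<i> * h' x v"
    using assms unfolding complex_C1_on_def by blast
  show ?thesis unfolding complex_C1_on_def
    by (rule exI[of _ "\<lambda>x. blinfun_mult_right c o\<^sub>L h' x"])
      (use h' in \<open>auto intro!: derivative_eq_intros continuous_intros\<close>)
qed

lemma complex_C1_on_cdir_scale:
  assumes "complex_C1_on S h" "x \<in> S"
  shows "cdir (c *s v) h x = c * cdir v h x"
proof -
  obtain h' where h': "(h has_derivative blinfun_apply (h' x)) (at x)" "\<And>v. h' x (\<i> *s v) = \<i> * h' x v"
    using assms unfolding complex_C1_on_def by blast
  show ?thesis
    unfolding cdir_eq_complex[OF h'(1) h'(2)]
    by (rule complex_homogeneous[OF blinfun.bounded_linear_right h'(2)])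
qed

lemma complex_C1_on_line:
  assumes "complex_C1_on S h" "a + \<zeta> *s v \<in> S"
  shows "((\<lambda>\<zeta>. h (a + \<zeta> *s v)) has_field_derivative cdir v h (a + \<zeta> *s v)) (at \<zeta>)"
proof -
  obtain h' where h': "(h has_derivative blinfun_apply (h' (a + \<zeta> *s v))) (at (a + \<zeta> *s v))"
    "\<forall>w. h' (a + \<zeta> *s v) (\<i> *s w) = \<i> * h' (a + \<zeta> *s v) w"
    using assms unfolding complex_C1_on_def by blast
  have "((\<lambda>\<zeta>. a + \<zeta> *s v) has_derivative (\<lambda>\<eta>. 0 + \<eta> *s v)) (at \<zeta>)"
    by (intro has_derivative_add has_derivative_const bounded_linear_imp_has_derivative bounded_linear_vscale_left)
  from has_derivative_compose[OF this h'(1)]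
  have "((\<lambda>\<zeta>. h (a + \<zeta> *s v)) has_derivative (\<lambda>\<eta>. h' (a + \<zeta> *s v) (\<eta> *s v))) (at \<zeta>)" by simp
  moreover have "h' (a + \<zeta> *s v) (\<eta> *s v) = cdir v h (a + \<zeta> *s v) * \<eta>" for \<eta>
    using h' complex_homogeneous[OF blinfun.bounded_linear_right, of "h' (a + \<zeta> *s v)" \<eta> v]
      cdir_eq_complex[OF h'(1)] by simp
  ultimately show ?thesis by (simp add: has_field_derivative_def)
qed

text \<open>Cauchy's formula on a complex line; the circle has radius \<open>1/2\<close> in the parameter.\<close>

lemma cdir_circle_integral:
  assumes h: "complex_C1_on S h" and sub: "\<And>\<zeta>. norm \<zeta> < 1 \<Longrightarrow> x + \<zeta> *s w \<in> S"
  shows "((\<lambda>t. h (x + (of_real (1/2) * cis t) *s w) * cis (- t)) has_integral of_real pi * cdir w h x) {0..2*pi}"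
proof -
  let ?k = "\<lambda>\<zeta>. h (x + \<zeta> *s w)"
  have k: "(?k has_field_derivative cdir w h (x + \<zeta> *s w)) (at \<zeta>)" if "norm \<zeta> < 1" for \<zeta>
    by (rule complex_C1_on_line[OF h sub[OF that]])
  then have hol: "?k holomorphic_on ball 0 1"
    unfolding holomorphic_on_def field_differentiable_def
    using k has_field_derivative_at_within by (metis mem_ball_0)
  have "(deriv ^^ 1) ?k 0 = cdir w h x"
    using DERIV_imp_deriv[OF k[of 0]] by simp
  then show ?thesis
    using has_integral_circle_coeff[OF hol, of "1/2" 1] by simp
qed

text \<open>Near \<open>x0\<close> the derivative in direction \<open>c u\<close>, with \<open>c\<close> so small that the discs of Cauchy's formula stay in
\<open>S\<close>, is an integral over a fixed circle. Differentiating under the integral shows that it is \<open>C\<^sup>1\<close>, and its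
derivative \<open>D\<close> is Cauchy's formula applied to \<open>cdir v h\<close>.\<close>

lemma cdir_local:
  fixes h :: "complex ^ 'n \<Rightarrow> complex"
  assumes S: "open S" and h: "complex_C1_on S h" and x0: "x0 \<in> S"
  obtains c U D where "c > (0::real)" "open U" "x0 \<in> U" "U \<subseteq> S"
    "\<And>x \<zeta>. x \<in> U \<Longrightarrow> norm \<zeta> < 1 \<Longrightarrow> x + \<zeta> *s (c *\<^sub>R u) \<in> S"
    "\<And>x. x \<in> U \<Longrightarrow> (cdir (c *\<^sub>R u) h has_derivative blinfun_apply (D x)) (at x)"
    "continuous_on U D"
    "\<And>x v. x \<in> U \<Longrightarrow> ((\<lambda>t. cdir v h (x + (of_real (1/2) * cis t) *s (c *\<^sub>R u)) * cis (- t)) has_integral of_real pi * D x v) {0..2*pi}"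
proof -
  obtain h' where h': "\<And>x. x \<in> S \<Longrightarrow> (h has_derivative blinfun_apply (h' x)) (at x)" "continuous_on S h'"
    "\<And>x v. x \<in> S \<Longrightarrow> h' x (\<i> *s v) = \<i> * h' x v"
    using h unfolding complex_C1_on_def by blast
  obtain r where r: "r > 0" "ball x0 r \<subseteq> S" using S x0 by (meson open_contains_ball)
  define c where "c = r / (2 * (norm u + 1))"
  have nu: "norm u + 1 > 0" by (simp add: add_nonneg_pos)
  have c: "c > 0" using r nu by (simp add: c_def)
  have cu: "c * norm u < r / 2" using r nu by (simp add: c_def field_simps)
  define w where "w = c *\<^sub>R u"
  have w: "norm w < r / 2" using c cu by (simp add: w_def)
  define U where "U = ball x0 (r/2)"
  have openU: "open U" by (simp add: U_def)
  have sub: "x + \<zeta> *s w \<in> S" if "x \<in> U" "norm \<zeta> < 1" for x \<zeta>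
  proof -
    have "dist x0 (x + \<zeta> *s w) \<le> dist x0 x + norm (\<zeta> *s w)"
      using norm_triangle_ineq4[of "x0 - x" "\<zeta> *s w"] by (simp add: dist_norm algebra_simps)
    also have "norm (\<zeta> *s w) \<le> norm w" using that by (simp add: norm_vscale mult_left_le_one_le)
    also have "dist x0 x + norm w < r" using that w by (simp add: U_def)
    finally show ?thesis using r by auto
  qed
  have sub': "x + (of_real (1/2) * cis t) *s w \<in> S" if "x \<in> U" for x t
    by (rule sub[OF that]) (simp add: norm_mult)
  define fx where "fx = (\<lambda>x t. blinfun_mult_right (cis (-t)) o\<^sub>L h' (x + (of_real (1/2) * cis t) *s w))"
  define D where "D = (\<lambda>x. (1 / pi) *\<^sub>R integral (cbox 0 (2*pi)) (fx x))"
  have cfx: "continuous_on (U \<times> cbox 0 (2*pi)) (\<lambda>(x, t). fx x t)"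
  proof -
    have A: "continuous_on (U \<times> cbox 0 (2*pi)) (\<lambda>p. (of_real (1/2) * cis (snd p)) *s w)"
      by (intro bounded_linear.continuous_on[OF bounded_linear_vscale_left] continuous_intros)
    have B: "continuous_on (U \<times> cbox 0 (2*pi)) (\<lambda>p. fst p + (of_real (1/2) * cis (snd p)) *s w)"
      by (rule continuous_on_add[OF continuous_on_fst[OF continuous_on_id] A])
    have C: "continuous_on (U \<times> cbox 0 (2*pi)) (\<lambda>p. h' (fst p + (of_real (1/2) * cis (snd p)) *s w))"
      by (rule continuous_on_compose2[OF h'(2) B]) (use sub' in auto)
    have D: "continuous_on (U \<times> cbox 0 (2*pi)) (\<lambda>p. blinfun_mult_right (cis (- snd p)) :: complex \<Rightarrow>\<^sub>L complex)"
      by (intro bounded_linear.continuous_on[OF bounded_linear_blinfun_mult_right] continuous_intros)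
    show ?thesis
      using bounded_bilinear.continuous_on[OF bounded_bilinear_blinfun_compose D C]
      by (simp only: fx_def case_prod_unfold)
  qed
  have int: "((\<lambda>t. h (x + (of_real (1/2) * cis t) *s w) * cis (- t)) has_integral of_real pi * cdir w h x) {0..2*pi}"
    if "x \<in> U" for x
    by (rule cdir_circle_integral[OF h sub[OF that]])
  have dfx: "((\<lambda>x. h (x + (of_real (1/2) * cis t) *s w) * cis (- t)) has_derivative blinfun_apply (fx y t)) (at y within U)"
    if y: "y \<in> U" for y t
  proof -
    have "((\<lambda>x. x + (of_real (1/2) * cis t) *s w) has_derivative (\<lambda>v. v + 0)) (at y)"
      by (intro has_derivative_add has_derivative_ident has_derivative_const)
    from has_derivative_compose[OF this h'(1)[OF sub'[OF y]]]
    have "((\<lambda>x. h (x + (of_real (1/2) * cis t) *s w)) has_derivative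
        (\<lambda>v. h' (y + (of_real (1/2) * cis t) *s w) v)) (at y)"
      by simp
    then have "((\<lambda>x. h (x + (of_real (1/2) * cis t) *s w) * cis (- t)) has_derivative
        (\<lambda>v. h' (y + (of_real (1/2) * cis t) *s w) v * cis (- t))) (at y)"
      by (rule has_derivative_mult_left)
    moreover have "(\<lambda>v. h' (y + (of_real (1/2) * cis t) *s w) v * cis (- t)) = blinfun_apply (fx y t)"
      by (simp add: fx_def fun_eq_iff mult.commute)
    ultimately show ?thesis by (simp only: has_derivative_at_withinI)
  qed
  have der: "(cdir w h has_derivative blinfun_apply (D x)) (at x)" if x: "x \<in> U" for x
  proof -
    define Q where "Q = (\<lambda>x t. h (x + (of_real (1/2) * cis t) *s w) * cis (- t))"
    have "((\<lambda>x. integral (cbox 0 (2*pi)) (Q x)) has_derivative integral (cbox 0 (2*pi)) (fx x)) (at x within U)"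
    proof (rule leibniz_rule[where f = Q and fx = fx and U = U])
      show "continuous_on (U \<times> cbox 0 (2*pi)) (\<lambda>(x, t). fx x t)" by (rule cfx)
      show "convex U" by (simp add: U_def)
      show "x \<in> U" by (rule x)
      show "((\<lambda>x. Q x t) has_derivative blinfun_apply (fx y t)) (at y within U)" if "y \<in> U" for y t
        unfolding Q_def by (rule dfx[OF that])
      show "Q y integrable_on cbox 0 (2*pi)" if "y \<in> U" for y
        using int[OF that] unfolding Q_def cbox_interval by (rule has_integral_integrable)
    qed
    then have "((\<lambda>x. integral (cbox 0 (2*pi)) (Q x)) has_derivative integral (cbox 0 (2*pi)) (fx x)) (at x)"
      unfolding at_within_open[OF x openU] .
    then have "((\<lambda>x. (1 / pi) *\<^sub>R integral (cbox 0 (2*pi)) (Q x))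
        has_derivative (\<lambda>v. (1 / pi) *\<^sub>R integral (cbox 0 (2*pi)) (fx x) v)) (at x)"
      by (rule has_derivative_scaleR_right)
    then have 1: "((\<lambda>x. (1 / pi) *\<^sub>R integral (cbox 0 (2*pi)) (Q x)) has_derivative blinfun_apply (D x)) (at x)"
      unfolding D_def blinfun.scaleR_left .
    have 2: "(1 / pi) *\<^sub>R integral (cbox 0 (2*pi)) (Q y) = cdir w h y" if "y \<in> U" for y
      using integral_unique[OF int[OF that]] by (simp add: Q_def scaleR_conv_of_real)
    show ?thesis by (rule has_derivative_cong_open[OF openU x 2 1])
  qed
  have contD: "continuous_on U D"
    unfolding D_def by (intro continuous_intros integral_continuous_on_param cfx)
  have intD: "((\<lambda>t. cdir v h (x + (of_real (1/2) * cis t) *s w) * cis (- t)) has_integral of_real pi * D x v) {0..2*pi}"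
    if x: "x \<in> U" for x v
  proof -
    have "continuous_on (cbox 0 (2*pi)) (fx x)"
      by (rule continuous_on_compose2[OF cfx, of _ "Pair x", unfolded prod.case])
        (use x in \<open>auto intro: continuous_intros\<close>)
    then have "(fx x has_integral integral (cbox 0 (2*pi)) (fx x)) (cbox 0 (2*pi))"
      by (intro integrable_integral integrable_continuous)
    from has_integral_linear[OF this blinfun.bounded_linear_left, of v]
    have "((\<lambda>t. fx x t v) has_integral of_real pi * D x v) {0..2*pi}"
      by (simp add: o_def D_def blinfun.scaleR_left scaleR_conv_of_real)
    moreover have "fx x t v = cdir v h (x + (of_real (1/2) * cis t) *s w) * cis (- t)" for t
      using cdir_eq_complex[OF h'(1)[OF sub'[OF x]] h'(3)[OF sub'[OF x]]] by (simp add: fx_def mult.commute)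
    ultimately show ?thesis by simp
  qed
  show thesis
  proof (rule that[OF c openU _ _ _ _ contD])
    show "x0 \<in> U" using r by (simp add: U_def)
    show "U \<subseteq> S" using r by (auto simp: U_def)
  qed (use sub der intD in \<open>simp_all only: w_def\<close>)
qed

lemma complex_C1_on_cdir:
  assumes S: "open S" and h: "complex_C1_on S h"
  shows "complex_C1_on S (cdir u h)"
proof (rule complex_C1_on_local)
  fix x0 assume x0: "x0 \<in> S"
  show "\<exists>U. open U \<and> x0 \<in> U \<and> complex_C1_on U (cdir u h)"
  proof (rule cdir_local[OF S h x0, of u])
    fix c U D assume *: "c > (0::real)" "open U" "x0 \<in> U" "U \<subseteq> S"
    "\<And>x \<zeta>. x \<in> U \<Longrightarrow> norm \<zeta> < 1 \<Longrightarrow> x + \<zeta> *s (c *\<^sub>R u) \<in> S"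
    "\<And>x. x \<in> U \<Longrightarrow> (cdir (c *\<^sub>R u) h has_derivative blinfun_apply (D x)) (at x)"
    "continuous_on U D"
    "\<And>x v. x \<in> U \<Longrightarrow> ((\<lambda>t. cdir v h (x + (of_real (1/2) * cis t) *s (c *\<^sub>R u)) * cis (- t)) has_integral of_real pi * D x v) {0..2*pi}"
    have "D x (\<i> *s v) = \<i> * D x v" if x: "x \<in> U" for x v
    proof -
      have "((\<lambda>t. cdir (\<i> *s v) h (x + (of_real (1/2) * cis t) *s (c *\<^sub>R u)) * cis (- t)) has_integral of_real pi * D x (\<i> *s v)) {0..2*pi}"
        by (rule *(8)[OF x])
      moreover have "cdir (\<i> *s v) h (x + (of_real (1/2) * cis t) *s (c *\<^sub>R u)) * cis (- t)
         = \<i> * (cdir v h (x + (of_real (1/2) * cis t) *s (c *\<^sub>R u)) * cis (- t))" for t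
        by (subst complex_C1_on_cdir_scale[OF h *(5)[OF x]]) (auto simp: norm_mult)
      moreover have "((\<lambda>t. \<i> * (cdir v h (x + (of_real (1/2) * cis t) *s (c *\<^sub>R u)) * cis (- t))) has_integral \<i> * (of_real pi * D x v)) {0..2*pi}"
        by (intro has_integral_mult_right *(8) x)
      ultimately have "of_real pi * D x (\<i> *s v) = \<i> * (of_real pi * D x v)"
        by (simp only: has_integral_unique)
      then show ?thesis by simp
    qed
    then have "complex_C1_on U (cdir (c *\<^sub>R u) h)"
      unfolding complex_C1_on_def using *(6,7) by blast
    then have "complex_C1_on U (\<lambda>x. of_real (1/c) * cdir (c *\<^sub>R u) h x)"
      by (rule complex_C1_on_cmult)
    moreover have "of_real (1/c) * cdir (c *\<^sub>R u) h x = cdir u h x" if "x \<in> U" for x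
      using *(1,4) that complex_C1_on_cdir_scale[OF h, of x "of_real c" u] by (auto simp: scaleR_vec_complex)
    ultimately have "complex_C1_on U (cdir u h)"
      by (rule complex_C1_on_cong[OF *(2)])
    then show ?thesis using *(2,3) by blast
  qed
qed

text \<open>The integral representing \<open>cdir v (cdir u h)\<close> is Cauchy's formula for \<open>cdir u\<close> of the function \<open>cdir v h\<close>.\<close>

lemma cdir_commute:
  assumes S: "open S" and h: "complex_C1_on S h" and x0: "x0 \<in> S"
  shows "cdir v (cdir u h) x0 = cdir u (cdir v h) x0"
proof (rule cdir_local[OF S h x0, of u])
  fix c U D assume *: "c > (0::real)" "open U" "x0 \<in> U" "U \<subseteq> S"
    "\<And>x \<zeta>. x \<in> U \<Longrightarrow> norm \<zeta> < 1 \<Longrightarrow> x + \<zeta> *s (c *\<^sub>R u) \<in> S"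
    "\<And>x. x \<in> U \<Longrightarrow> (cdir (c *\<^sub>R u) h has_derivative blinfun_apply (D x)) (at x)"
    "continuous_on U D"
    "\<And>x v. x \<in> U \<Longrightarrow> ((\<lambda>t. cdir v h (x + (of_real (1/2) * cis t) *s (c *\<^sub>R u)) * cis (- t)) has_integral of_real pi * D x v) {0..2*pi}"
  have C: "complex_C1_on S (cdir w h)" for w by (rule complex_C1_on_cdir[OF S h])
  have "of_real pi * D x0 v = of_real pi * cdir (c *\<^sub>R u) (cdir v h) x0"
    by (rule has_integral_unique[OF *(8)[OF *(3)] cdir_circle_integral[OF C *(5)[OF *(3)]]])
  then have 1: "D x0 v = of_real c * cdir u (cdir v h) x0"
    by (simp add: scaleR_vec_complex complex_C1_on_cdir_scale[OF C x0])
  have "cdir v (cdir (c *\<^sub>R u) h) x0 = D x0 v"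
  proof (rule cdir_eq_complex[OF *(6)[OF *(3)]])
    obtain k where k: "(cdir (c *\<^sub>R u) h has_derivative blinfun_apply (k x0)) (at x0)" "\<And>v. k x0 (\<i> *s v) = \<i> * k x0 v"
      using C[of "c *\<^sub>R u"] x0 unfolding complex_C1_on_def by blast
    have "blinfun_apply (D x0) = blinfun_apply (k x0)"
      by (rule has_derivative_unique[OF *(6)[OF *(3)] k(1)])
    then show "D x0 (\<i> *s v) = \<i> * D x0 v" using k(2) by simp
  qed
  moreover have "cdir v (cdir (c *\<^sub>R u) h) x0 = of_real c * cdir v (cdir u h) x0"
  proof -
    have "cdir v (cdir (c *\<^sub>R u) h) x0 = cdir v (\<lambda>x. of_real c * cdir u h x) x0"
      by (rule cdir_cong[OF S x0]) (simp add: scaleR_vec_complex complex_C1_on_cdir_scale[OF h])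
    also have "\<dots> = of_real c * cdir v (cdir u h) x0"
    proof -
      obtain k where k: "(cdir u h has_derivative blinfun_apply (k x0)) (at x0)"
        using C[of u] x0 unfolding complex_C1_on_def by blast
      have "((\<lambda>x. of_real c * cdir u h x) has_derivative (\<lambda>v. of_real c * k x0 v)) (at x0)"
        by (rule has_derivative_mult_right[OF k])
      from cdir_eq[OF this] cdir_eq[OF k] show ?thesis by (simp only:) (simp add: field_simps)
    qed
    finally show ?thesis .
  qed
  ultimately show ?thesis using 1 *(1) by simp
qed

section \<open>Pluriharmonic functions and their restrictions to complex lines\<close>

text \<open>The last condition says that the Levi form of \<open>f\<close> vanishes, that is, that all mixed derivatives
\<open>\<partial>\<^sup>2 f / \<partial>z\<^sub>j \<partial>cnj z\<^sub>k\<close> are zero. In this form pluriharmonicity is visibly stable under conjugation.\<close>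

definition levi_flat_on :: "(complex ^ 'n) set \<Rightarrow> (complex ^ 'n \<Rightarrow> complex) \<Rightarrow> bool"
  where "levi_flat_on S f \<longleftrightarrow>
    (\<exists>(f' :: complex ^ 'n \<Rightarrow> (complex ^ 'n) \<Rightarrow>\<^sub>L complex)
       (f'' :: complex ^ 'n \<Rightarrow> (complex ^ 'n) \<Rightarrow>\<^sub>L (complex ^ 'n) \<Rightarrow>\<^sub>L complex).
       (\<forall>x\<in>S. (f has_derivative blinfun_apply (f' x)) (at x)) \<and>
       (\<forall>x\<in>S. (f' has_derivative blinfun_apply (f'' x)) (at x)) \<and>
       continuous_on S f'' \<and>
       (\<forall>x\<in>S. \<forall>u v. f'' x (\<i> *s u) (\<i> *s v) = - f'' x u v))"

lemma boundary_dist_pos: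
  assumes "open S" "x \<in> S"
  obtains r where "r > 0" "ball x r \<subseteq> S" "ereal r \<le> boundary_dist S x"
proof -
  obtain r where r: "r > 0" "ball x r \<subseteq> S" using assms by (meson open_contains_ball)
  have "ereal r \<le> boundary_dist S x"
    unfolding boundary_dist_def
  proof (rule INF_greatest)
    fix w assume "w \<in> frontier S"
    then have "w \<notin> ball x r" using r(2) assms(1) by (auto simp: frontier_def interior_open)
    then show "ereal r \<le> ereal (dist x w)" by simp
  qed
  with r show thesis by (rule that)
qed

lemma line_has_derivative:
  fixes k :: "complex ^ 'n \<Rightarrow> 'b::real_normed_vector"
  assumes "(k has_derivative k') (at (a + \<zeta> *s v))"
  shows "((\<lambda>\<zeta>. k (a + \<zeta> *s v)) has_derivative (\<lambda>\<eta>. k' (\<eta> *s v))) (at \<zeta>)"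
proof -
  have "((\<lambda>\<zeta>. a + \<zeta> *s v) has_derivative (\<lambda>\<eta>. 0 + \<eta> *s v)) (at \<zeta>)"
    by (intro has_derivative_add has_derivative_const bounded_linear_imp_has_derivative bounded_linear_vscale_left)
  from has_derivative_compose[OF this assms] show ?thesis by simp
qed

lemma slice_laplacian:
  fixes f :: "complex ^ 'n \<Rightarrow> complex"
    and f' :: "complex ^ 'n \<Rightarrow> (complex ^ 'n) \<Rightarrow>\<^sub>L complex"
    and F :: "(complex ^ 'n) \<Rightarrow>\<^sub>L (complex ^ 'n) \<Rightarrow>\<^sub>L complex"
  assumes r: "r > 0" "ball x r \<subseteq> S"
    and f': "\<And>y. y \<in> S \<Longrightarrow> (f has_derivative blinfun_apply (f' y)) (at y)"
    and F: "(f' has_derivative blinfun_apply F) (at x)" and \<theta>: "norm \<theta> = 1"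
  shows "dir_deriv c (dir_deriv c (\<lambda>\<zeta>. f (x + \<zeta> *s \<theta>))) 0 = F (c *s \<theta>) (c *s \<theta>)"
proof -
  let ?g = "\<lambda>\<zeta>. f (x + \<zeta> *s \<theta>)"
  have 1: "dir_deriv c ?g \<zeta> = f' (x + \<zeta> *s \<theta>) (c *s \<theta>)" if "\<zeta> \<in> ball 0 r" for \<zeta>
  proof -
    have "x + \<zeta> *s \<theta> \<in> ball x r" using that \<theta> by (simp add: dist_norm norm_vscale)
    then have "x + \<zeta> *s \<theta> \<in> S" using r by blast
    from dir_deriv_eq[OF line_has_derivative[OF f'[OF this]]] show ?thesis .
  qed
  have "dir_deriv c (dir_deriv c ?g) 0 = dir_deriv c (\<lambda>\<zeta>. f' (x + \<zeta> *s \<theta>) (c *s \<theta>)) 0"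
    using r by (intro dir_deriv_cong[of "ball 0 r"] 1) auto
  also have "\<dots> = F (c *s \<theta>) (c *s \<theta>)"
  proof -
    have "(f' has_derivative blinfun_apply F) (at (x + 0 *s \<theta>))" using F by simp
    from bounded_linear.has_derivative[OF blinfun.bounded_linear_left[of "c *s \<theta>"] line_has_derivative[OF this]]
    show ?thesis by (rule dir_deriv_eq)
  qed
  finally show ?thesis .
qed

text \<open>Harmonicity on the line in direction \<open>\<theta>\<close> is \<open>f'' \<theta> \<theta> + f'' (\<i> \<theta>) (\<i> \<theta>) = 0\<close>. The left side is the quadratic
form of a symmetric bilinear form, and polarization makes the bilinear form vanish.\<close>

lemma pluriharmonic_imp_levi_flat:
  fixes f :: "complex ^ 'n \<Rightarrow> complex"
  assumes S: "open S" and f: "pluriharmonic_on S f"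
  shows "levi_flat_on S f"
proof -
  obtain f' :: "complex ^ 'n \<Rightarrow> (complex ^ 'n) \<Rightarrow>\<^sub>L complex" and f'' where
    f': "\<And>x. x \<in> S \<Longrightarrow> (f has_derivative blinfun_apply (f' x)) (at x)" and
    f'': "\<And>x. x \<in> S \<Longrightarrow> (f' has_derivative blinfun_apply (f'' x)) (at x)" and
    cont: "continuous_on S f''"
    using f unfolding pluriharmonic_on_def C2_on_def by blast
  have "f'' x (\<i> *s u) (\<i> *s v) = - f'' x u v" if x: "x \<in> S" for x u v
  proof -
    obtain r where r: "r > 0" "ball x r \<subseteq> S" "ereal r \<le> boundary_dist S x"
      using boundary_dist_pos[OF S x] .
    define Q where "Q = (\<lambda>u v. f'' x u v + f'' x (\<i> *s u) (\<i> *s v))"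
    have sym: "f'' x u v = f'' x v u" for u v
      by (rule second_derivative_symmetric[OF S x f' f''[OF x]])
    have unit: "Q \<theta> \<theta> = 0" if "norm \<theta> = 1" for \<theta>
    proof -
      have "ereal (norm (0::complex)) < ereal r" using r(1) by simp
      then have "ereal (norm (0::complex)) < boundary_dist S x" using r(3) by (rule less_le_trans)
      then have "dir_deriv 1 (dir_deriv 1 (\<lambda>\<zeta>. f (x + \<zeta> *s \<theta>))) 0
          + dir_deriv \<i> (dir_deriv \<i> (\<lambda>\<zeta>. f (x + \<zeta> *s \<theta>))) 0 = 0"
        using f x that unfolding pluriharmonic_on_def harmonic_on_def by blast
      moreover have "dir_deriv c (dir_deriv c (\<lambda>\<zeta>. f (x + \<zeta> *s \<theta>))) 0 = f'' x (c *s \<theta>) (c *s \<theta>)" for c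
        by (rule slice_laplacian[OF r(1,2) f' f''[OF x] that])
      ultimately show ?thesis by (simp add: Q_def)
    qed
    have diag: "Q w w = 0" for w
    proof (cases "w = 0")
      case False
      define \<theta> where "\<theta> = (1 / norm w) *\<^sub>R w"
      have w: "w = norm w *\<^sub>R \<theta>" and "norm \<theta> = 1" using False by (auto simp: \<theta>_def)
      have i: "\<i> *s (c *\<^sub>R t) = c *\<^sub>R (\<i> *s t)" for c and t :: "complex ^ 'n"
        by (simp add: vec_eq_iff)
      have "Q (c *\<^sub>R t) (c *\<^sub>R t) = (c * c) *\<^sub>R Q t t" for c t
        by (simp add: Q_def i blinfun.scaleR_left blinfun.scaleR_right scaleR_add_right)
      then show ?thesis using unit[OF \<open>norm \<theta> = 1\<close>] w by (metis scaleR_zero_right)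
    qed (simp add: Q_def)
    have "Q (u + v) (u + v) = Q u u + Q v v + 2 * Q u v"
      using sym[of v u] sym[of "\<i> *s v" "\<i> *s u"]
      by (simp add: Q_def vector_add_ldistrib blinfun.add_left blinfun.add_right algebra_simps)
    then have "Q u v = 0" by (simp add: diag)
    then show ?thesis by (simp add: Q_def add_eq_0_iff)
  qed
  then show ?thesis unfolding levi_flat_on_def using f' f'' cont by blast
qed

lemma levi_flat_cnj:
  fixes f :: "complex ^ 'n \<Rightarrow> complex"
  assumes "levi_flat_on S f"
  shows "levi_flat_on S (\<lambda>x. cnj (f x))"
proof -
  obtain f' :: "complex ^ 'n \<Rightarrow> (complex ^ 'n) \<Rightarrow>\<^sub>L complex" and f'' where
    f': "\<And>x. x \<in> S \<Longrightarrow> (f has_derivative blinfun_apply (f' x)) (at x)" and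
    f'': "\<And>x. x \<in> S \<Longrightarrow> (f' has_derivative blinfun_apply (f'' x)) (at x)" and
    cont: "continuous_on S f''" and
    flat: "\<And>x u v. x \<in> S \<Longrightarrow> f'' x (\<i> *s u) (\<i> *s v) = - f'' x u v"
    using assms unfolding levi_flat_on_def by blast
  define C where "C = Blinfun cnj"
  have C: "blinfun_apply C = cnj" by (simp add: C_def bounded_linear_Blinfun_apply bounded_linear_cnj)
  have bl: "bounded_linear (\<lambda>L :: (complex ^ 'n) \<Rightarrow>\<^sub>L complex. C o\<^sub>L L)"
    by (rule bounded_bilinear.bounded_linear_right[OF bounded_bilinear_blinfun_compose])
  define K where "K = Blinfun (\<lambda>L :: (complex ^ 'n) \<Rightarrow>\<^sub>L complex. C o\<^sub>L L)"
  have K: "blinfun_apply K = (\<lambda>L. C o\<^sub>L L)" by (simp add: K_def bounded_linear_Blinfun_apply bl)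
  show ?thesis unfolding levi_flat_on_def
  proof (intro exI[of _ "\<lambda>x. C o\<^sub>L f' x"] exI[of _ "\<lambda>x. K o\<^sub>L f'' x"] conjI ballI allI)
    fix x assume x: "x \<in> S"
    have "blinfun_apply (C o\<^sub>L f' x) = (\<lambda>v. cnj (f' x v))" by (simp add: C fun_eq_iff)
    then show "((\<lambda>x. cnj (f x)) has_derivative blinfun_apply (C o\<^sub>L f' x)) (at x)"
      using bounded_linear.has_derivative[OF bounded_linear_cnj f'[OF x]] by (simp only:)
    have "blinfun_apply (K o\<^sub>L f'' x) = (\<lambda>v. C o\<^sub>L f'' x v)" by (simp add: K fun_eq_iff)
    then show "((\<lambda>x. C o\<^sub>L f' x) has_derivative blinfun_apply (K o\<^sub>L f'' x)) (at x)"
      using bounded_linear.has_derivative[OF bl f''[OF x]] by (simp only:)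
    fix u v
    show "blinfun_apply (blinfun_apply (K o\<^sub>L f'' x) (\<i> *s u)) (\<i> *s v) = - blinfun_apply (blinfun_apply (K o\<^sub>L f'' x) u) v"
      by (simp add: K C flat[OF x])
  next
    show "continuous_on S (\<lambda>x. K o\<^sub>L f'' x)"
      by (rule bounded_bilinear.continuous_on[OF bounded_bilinear_blinfun_compose continuous_on_const cont])
  qed
qed

text \<open>The derivative of \<open>cdir v f\<close> along \<open>u\<close> is \<open>(f'' u v - \<i> f'' u (\<i> v)) / 2\<close>; the vanishing of the Levi form is exactly
its complex linearity in \<open>u\<close>, and its symmetry in \<open>u, v\<close> follows from that of \<open>f''\<close>.\<close>

lemma levi_flat_cdir:
  fixes f :: "complex ^ 'n \<Rightarrow> complex"
  assumes S: "open S" and "levi_flat_on S f"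
  shows "complex_C1_on S (cdir v f)"
    and "x \<in> S \<Longrightarrow> cdir u (cdir v f) x = cdir v (cdir u f) x"
proof -
  obtain f' :: "complex ^ 'n \<Rightarrow> (complex ^ 'n) \<Rightarrow>\<^sub>L complex" and f'' where
    f': "\<And>x. x \<in> S \<Longrightarrow> (f has_derivative blinfun_apply (f' x)) (at x)" and
    f'': "\<And>x. x \<in> S \<Longrightarrow> (f' has_derivative blinfun_apply (f'' x)) (at x)" and
    cont: "continuous_on S f''" and
    flat: "\<And>x u v. x \<in> S \<Longrightarrow> f'' x (\<i> *s u) (\<i> *s v) = - f'' x u v"
    using assms unfolding levi_flat_on_def by blast
  have flat': "f'' x (\<i> *s u) v = f'' x u (\<i> *s v)" if "x \<in> S" for x u v
  proof -
    have "\<i> *s (\<i> *s v) = - v" by (simp add: vector_smult_assoc vec_eq_iff)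
    then show ?thesis using flat[OF that, of u "\<i> *s v"] by (simp add: blinfun.minus_right)
  qed
  define B where "B = (\<lambda>v. Blinfun (\<lambda>L :: (complex ^ 'n) \<Rightarrow>\<^sub>L complex. (L v - \<i> * L (\<i> *s v)) / 2))"
  have B: "blinfun_apply (B v) = (\<lambda>L. (L v - \<i> * L (\<i> *s v)) / 2)" for v
    unfolding B_def
    by (intro bounded_linear_Blinfun_apply bounded_linear_sub bounded_linear_const_mult
        blinfun.bounded_linear_left bounded_linear_compose[OF bounded_linear_divide, of _ 2])
  have cd: "cdir v f x = B v (f' x)" if "x \<in> S" for x v
    by (simp add: cdir_eq[OF f'[OF that]] B)
  have D: "(cdir v f has_derivative blinfun_apply (B v o\<^sub>L f'' x)) (at x)" if x: "x \<in> S" for x v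
  proof -
    have "((\<lambda>x. B v (f' x)) has_derivative (\<lambda>u. B v (f'' x u))) (at x)"
      by (rule bounded_linear.has_derivative[OF blinfun.bounded_linear_right f''[OF x]])
    moreover have "blinfun_apply (B v o\<^sub>L f'' x) = (\<lambda>u. B v (f'' x u))" by (simp add: fun_eq_iff)
    ultimately have "((\<lambda>x. B v (f' x)) has_derivative blinfun_apply (B v o\<^sub>L f'' x)) (at x)" by (simp only:)
    from has_derivative_cong_open[OF S x _ this] show ?thesis by (simp add: cd)
  qed
  have ci: "(B v o\<^sub>L f'' x) (\<i> *s w) = \<i> * (B v o\<^sub>L f'' x) w" if x: "x \<in> S" for x v w
    by (simp add: B flat'[OF x] flat[OF x] blinfun.minus_right algebra_simps)
  show "complex_C1_on S (cdir v f)"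
    unfolding complex_C1_on_def
  proof (intro exI[of _ "\<lambda>x. B v o\<^sub>L f'' x"] conjI ballI allI D ci)
    show "continuous_on S (\<lambda>x. B v o\<^sub>L f'' x)"
      by (rule bounded_bilinear.continuous_on[OF bounded_bilinear_blinfun_compose continuous_on_const cont])
  qed
  show "cdir u (cdir v f) x = cdir v (cdir u f) x" if x: "x \<in> S" for x
  proof -
    have sym: "f'' x u v = f'' x v u" for u v
      by (rule second_derivative_symmetric[OF S x f' f''[OF x]])
    show ?thesis
      unfolding cdir_eq_complex[OF D[OF x] ci[OF x]]
      by (simp add: B) (metis flat'[OF x] sym)
  qed
qed

lemma cdir_sum:
  assumes "(f has_derivative f') (at x)" "finite A"
  shows "cdir (\<Sum>j\<in>A. c j *s v j) f x = (\<Sum>j\<in>A. c j * cdir (v j) f x)"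
proof -
  interpret f': bounded_linear f' by (rule has_derivative_bounded_linear[OF assms(1)])
  define L where "L = (\<lambda>w. (f' w - \<i> * f' (\<i> *s w)) / 2)"
  have bl: "bounded_linear L"
    unfolding L_def
    by (intro bounded_linear_sub bounded_linear_const_mult f'.bounded_linear_axioms
        bounded_linear_compose[OF bounded_linear_divide, of _ 2]
        bounded_linear_compose[OF f'.bounded_linear_axioms bounded_linear_vscale_right])
  have i: "L (\<i> *s w) = \<i> * L w" for w
  proof -
    have "\<i> *s (\<i> *s w) = - w" by (simp add: vector_smult_assoc vec_eq_iff)
    then show ?thesis by (simp add: L_def linear_neg[OF f'.linear] field_simps)
  qed
  have "L (\<Sum>j\<in>A. c j *s v j) = (\<Sum>j\<in>A. c j * L (v j))"
    by (simp add: linear_sum[OF bounded_linear.linear[OF bl]] complex_homogeneous[OF bl i])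
  then show ?thesis by (simp add: cdir_eq[OF assms(1)] L_def)
qed

lemma derivative_from_cdir:
  assumes "(f has_derivative f') (at x)"
  shows "f' v = cdir v f x + cnj (cdir v (\<lambda>y. cnj (f y)) x)"
  unfolding cdir_eq[OF assms] cdir_eq[OF bounded_linear.has_derivative[OF bounded_linear_cnj assms]]
  by (simp add: field_simps)

text \<open>The derivatives of \<open>f\<close> and of its conjugate along the line are holomorphic on the disc and have
primitives \<open>H\<close> and \<open>G\<close> there; \<open>f - H - cnj G\<close> has zero differential, and the constant is absorbed into \<open>H\<close>.\<close>

lemma slice_decomposition:
  fixes f :: "complex ^ 'n \<Rightarrow> complex"
  assumes S: "open S" and f: "levi_flat_on S f" and sub: "\<And>\<zeta>. norm \<zeta> < 1 \<Longrightarrow> a + \<zeta> *s v \<in> S"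
  obtains H G where "H holomorphic_on ball 0 1" "G holomorphic_on ball 0 1"
    "\<And>\<zeta>. norm \<zeta> < 1 \<Longrightarrow> f (a + \<zeta> *s v) = H \<zeta> + cnj (G \<zeta>)"
    "\<And>\<zeta>. norm \<zeta> < 1 \<Longrightarrow> deriv H \<zeta> = cdir v f (a + \<zeta> *s v)"
    "\<And>\<zeta>. norm \<zeta> < 1 \<Longrightarrow> deriv G \<zeta> = cdir v (\<lambda>y. cnj (f y)) (a + \<zeta> *s v)"
proof -
  have prim: "\<exists>H. \<forall>\<zeta>\<in>ball 0 1. (H has_field_derivative cdir v k (a + \<zeta> *s v)) (at \<zeta>)"
    if k: "levi_flat_on S k" for k
  proof -
    have "(\<lambda>\<zeta>. cdir v k (a + \<zeta> *s v)) holomorphic_on ball 0 1"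
      unfolding holomorphic_on_def field_differentiable_def
      using complex_C1_on_line[OF levi_flat_cdir(1)[OF S k] sub] has_field_derivative_at_within
      by (metis mem_ball_0)
    from holomorphic_convex_primitive'[OF convex_ball open_ball this]
    obtain H where "\<And>\<zeta>. \<zeta> \<in> ball 0 1 \<Longrightarrow> (H has_field_derivative cdir v k (a + \<zeta> *s v)) (at \<zeta> within ball 0 1)"
      by blast
    then show ?thesis by (metis at_within_open open_ball)
  qed
  obtain H where H: "\<And>\<zeta>. norm \<zeta> < 1 \<Longrightarrow> (H has_field_derivative cdir v f (a + \<zeta> *s v)) (at \<zeta>)"
    using prim[OF f] unfolding Ball_def mem_ball_0 by blast
  obtain G where G: "\<And>\<zeta>. norm \<zeta> < 1 \<Longrightarrow> (G has_field_derivative cdir v (\<lambda>y. cnj (f y)) (a + \<zeta> *s v)) (at \<zeta>)"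
    using prim[OF levi_flat_cnj[OF f]] unfolding Ball_def mem_ball_0 by blast
  obtain f' :: "complex ^ 'n \<Rightarrow> (complex ^ 'n) \<Rightarrow>\<^sub>L complex" where
    f': "\<And>x. x \<in> S \<Longrightarrow> (f has_derivative blinfun_apply (f' x)) (at x)"
    using f unfolding levi_flat_on_def by blast
  have "((\<lambda>\<zeta>. f (a + \<zeta> *s v) - H \<zeta> - cnj (G \<zeta>)) has_derivative (\<lambda>_. 0)) (at \<zeta> within ball 0 1)"
    if \<zeta>: "\<zeta> \<in> ball 0 1" for \<zeta>
  proof -
    have n: "norm \<zeta> < 1" using \<zeta> by simp
    let ?p = "cdir v f (a + \<zeta> *s v)" and ?q = "cdir v (\<lambda>y. cnj (f y)) (a + \<zeta> *s v)"
    have fa: "(f has_derivative blinfun_apply (f' (a + \<zeta> *s v))) (at (a + \<zeta> *s v))"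
      by (rule f'[OF sub[OF n]])
    have "((\<lambda>\<zeta>. f (a + \<zeta> *s v) - H \<zeta> - cnj (G \<zeta>)) has_derivative
       (\<lambda>\<eta>. f' (a + \<zeta> *s v) (\<eta> *s v) - ?p * \<eta> - cnj (?q * \<eta>))) (at \<zeta>)"
      by (intro has_derivative_diff line_has_derivative fa bounded_linear.has_derivative[OF bounded_linear_cnj]
          H[OF n, unfolded has_field_derivative_def] G[OF n, unfolded has_field_derivative_def])
    moreover have "f' (a + \<zeta> *s v) (\<eta> *s v) - ?p * \<eta> - cnj (?q * \<eta>) = 0" for \<eta>
    proof -
      have sc: "cdir (\<eta> *s v) k y = \<eta> * cdir v k y" if "(k has_derivative k') (at y)" for k k' y
        using cdir_sum[OF that, of "{()}" "\<lambda>_. \<eta>" "\<lambda>_. v"] by simp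
      show ?thesis
        using derivative_from_cdir[OF fa, of "\<eta> *s v"] sc[OF fa]
          sc[OF bounded_linear.has_derivative[OF bounded_linear_cnj fa]] by simp
    qed
    ultimately show ?thesis by (simp add: has_derivative_at_withinI)
  qed
  then obtain c where c: "\<And>\<zeta>. \<zeta> \<in> ball 0 1 \<Longrightarrow> f (a + \<zeta> *s v) - H \<zeta> - cnj (G \<zeta>) = c"
    using has_derivative_zero_constant[of "ball 0 1" "\<lambda>\<zeta>. f (a + \<zeta> *s v) - H \<zeta> - cnj (G \<zeta>)"] by auto
  have Hc: "((\<lambda>\<zeta>. H \<zeta> + c) has_field_derivative cdir v f (a + \<zeta> *s v)) (at \<zeta>)" if "norm \<zeta> < 1" for \<zeta>
    using DERIV_add[OF H[OF that] DERIV_const[of c]] by simp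
  show thesis
  proof (rule that[of "\<lambda>\<zeta>. H \<zeta> + c" G])
    show "(\<lambda>\<zeta>. H \<zeta> + c) holomorphic_on ball 0 1" "G holomorphic_on ball 0 1"
      unfolding holomorphic_on_def field_differentiable_def
      using Hc G has_field_derivative_at_within by (metis mem_ball_0)+
    fix \<zeta> :: complex assume \<zeta>: "norm \<zeta> < 1"
    show "f (a + \<zeta> *s v) = H \<zeta> + c + cnj (G \<zeta>)" using c[of \<zeta>] \<zeta> by (simp add: algebra_simps)
    show "deriv (\<lambda>\<zeta>. H \<zeta> + c) \<zeta> = cdir v f (a + \<zeta> *s v)" by (rule DERIV_imp_deriv[OF Hc[OF \<zeta>]])
    show "deriv G \<zeta> = cdir v (\<lambda>y. cnj (f y)) (a + \<zeta> *s v)" by (rule DERIV_imp_deriv[OF G[OF \<zeta>]])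
  qed
qed

lemma higher_deriv_line:
  assumes S: "open S" and k: "complex_C1_on S k" and sub: "\<And>\<zeta>. norm \<zeta> < 1 \<Longrightarrow> a + \<zeta> *s v \<in> S"
    and K: "\<And>\<zeta>. norm \<zeta> < 1 \<Longrightarrow> K \<zeta> = k (a + \<zeta> *s v)" and \<zeta>: "norm \<zeta> < 1"
  shows "(deriv ^^ n) K \<zeta> = (cdir v ^^ n) k (a + \<zeta> *s v)"
  using k K
proof (induction n arbitrary: k K)
  case 0
  then show ?case using \<zeta> by simp
next
  case (Suc n)
  have "deriv K \<xi> = cdir v k (a + \<xi> *s v)" if \<xi>: "norm \<xi> < 1" for \<xi>
  proof -
    have "(K has_field_derivative cdir v k (a + \<xi> *s v)) (at \<xi>)"
      by (rule has_field_derivative_transform_within_open[OF complex_C1_on_line[OF Suc.prems(1) sub[OF \<xi>]], of "ball 0 1"])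
        (use \<xi> Suc.prems(2) in auto)
    then show ?thesis by (rule DERIV_imp_deriv)
  qed
  from Suc.IH[OF complex_C1_on_cdir[OF S Suc.prems(1)] this]
  show ?case by (simp only: funpow_Suc_right o_apply)
qed

lemma line_derivative_bound:
  fixes f :: "complex ^ 'n \<Rightarrow> complex"
  assumes S: "open S" and f: "levi_flat_on S f" and bd: "\<And>x. x \<in> S \<Longrightarrow> norm (f x) \<le> 1"
    and sub: "\<And>\<zeta>. norm \<zeta> < 1 \<Longrightarrow> a + \<zeta> *s v \<in> S"
    and m: "m \<ge> 1" and \<zeta>: "norm \<zeta> < 1"
  shows "norm ((cdir v ^^ m) f (a + \<zeta> *s v)) + norm ((cdir v ^^ m) (\<lambda>y. cnj (f y)) (a + \<zeta> *s v))
    \<le> 4 / pi * fact m * ((1 + norm \<zeta>) ^ (m - 1) / (1 - (norm \<zeta>)\<^sup>2) ^ m)"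
proof -
  obtain n where n: "m = Suc n" using m by (cases m) auto
  obtain H G where HG: "H holomorphic_on ball 0 1" "G holomorphic_on ball 0 1"
    "\<And>\<zeta>. norm \<zeta> < 1 \<Longrightarrow> f (a + \<zeta> *s v) = H \<zeta> + cnj (G \<zeta>)"
    "\<And>\<zeta>. norm \<zeta> < 1 \<Longrightarrow> deriv H \<zeta> = cdir v f (a + \<zeta> *s v)"
    "\<And>\<zeta>. norm \<zeta> < 1 \<Longrightarrow> deriv G \<zeta> = cdir v (\<lambda>y. cnj (f y)) (a + \<zeta> *s v)"
    using slice_decomposition[OF S f sub] by blast
  have "(deriv ^^ m) H \<zeta> = (cdir v ^^ m) f (a + \<zeta> *s v)"
    unfolding n funpow_Suc_right o_apply
    by (rule higher_deriv_line[OF S levi_flat_cdir(1)[OF S f] sub HG(4) \<zeta>])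
  moreover have "(deriv ^^ m) G \<zeta> = (cdir v ^^ m) (\<lambda>y. cnj (f y)) (a + \<zeta> *s v)"
    unfolding n funpow_Suc_right o_apply
    by (rule higher_deriv_line[OF S levi_flat_cdir(1)[OF S levi_flat_cnj[OF f]] sub HG(5) \<zeta>])
  moreover have "norm (H \<xi> + cnj (G \<xi>)) \<le> 1" if "norm \<xi> < 1" for \<xi>
    using bd[OF sub[OF that]] HG(3)[OF that] by simp
  ultimately show ?thesis
    using disc_derivative_bound[OF HG(1,2) _ m \<zeta>] by simp
qed

section \<open>Mixed derivatives from directional derivatives\<close>

text \<open>The common properties of \<open>f\<close> itself, which is not holomorphic, and of its derivatives, which are. They
are what an induction over iterated derivatives of \<open>f\<close> uses.\<close>

definition cdir_regular_on :: "(complex ^ 'n) set \<Rightarrow> (complex ^ 'n \<Rightarrow> complex) \<Rightarrow> bool"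
  where "cdir_regular_on S f \<longleftrightarrow> (\<forall>x\<in>S. \<exists>D. (f has_derivative D) (at x)) \<and>
    (\<forall>v. complex_C1_on S (cdir v f)) \<and>
    (\<forall>x\<in>S. \<forall>u v. cdir u (cdir v f) x = cdir v (cdir u f) x)"

lemma cdir_regularD:
  assumes "cdir_regular_on S f"
  shows "x \<in> S \<Longrightarrow> \<exists>D. (f has_derivative D) (at x)" "complex_C1_on S (cdir v f)"
    "x \<in> S \<Longrightarrow> cdir u (cdir v f) x = cdir v (cdir u f) x"
  using assms unfolding cdir_regular_on_def by blast+

lemma levi_flat_imp_cdir_regular:
  assumes "open S" "levi_flat_on S f"
  shows "cdir_regular_on S f"
  unfolding cdir_regular_on_def
proof (intro conjI ballI allI)
  fix x assume "x \<in> S"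
  then show "\<exists>D. (f has_derivative D) (at x)" using assms(2) unfolding levi_flat_on_def by blast
qed (rule levi_flat_cdir[OF assms]; assumption?)+

lemma complex_C1_imp_cdir_regular:
  assumes "open S" "complex_C1_on S f"
  shows "cdir_regular_on S f"
  unfolding cdir_regular_on_def
proof (intro conjI ballI allI)
  fix x assume "x \<in> S"
  then show "\<exists>D. (f has_derivative D) (at x)" using assms(2) unfolding complex_C1_on_def by blast
qed (rule complex_C1_on_cdir[OF assms] cdir_commute[OF assms]; assumption?)+

text \<open>Iterated derivatives are indexed by words in the coordinates: the expansion of an iterated directional
derivative over words has no multinomial coefficients, which appear only when words with equal
letter counts are collected.\<close>

definition word_deriv :: "'n list \<Rightarrow> (complex ^ 'n::finite \<Rightarrow> complex) \<Rightarrow> complex ^ 'n \<Rightarrow> complex"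
  where "word_deriv w f = foldr (\<lambda>j. cdir (axis j 1)) w f"

lemma word_deriv_simps [simp]:
  "word_deriv [] f = f" "word_deriv (j # w) f = cdir (axis j 1) (word_deriv w f)"
  by (simp_all add: word_deriv_def)

lemma cdir_regular_word_deriv:
  assumes "open S" "cdir_regular_on S f"
  shows "cdir_regular_on S (word_deriv w f)"
proof (induction w)
  case Nil
  show ?case by (simp add: assms(2))
next
  case (Cons j w)
  show ?case
    unfolding word_deriv_simps
    by (rule complex_C1_imp_cdir_regular[OF assms(1) cdir_regularD(2)[OF Cons.IH]])
qed

lemma word_deriv_move:
  assumes S: "open S" and f: "cdir_regular_on S f" and x: "x \<in> S"
  shows "word_deriv (a @ j # b) f x = word_deriv (j # a @ b) f x"
  using x
proof (induction a arbitrary: x)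
  case (Cons i a)
  have "word_deriv ((i # a) @ j # b) f x = cdir (axis i 1) (word_deriv (a @ j # b) f) x"
    by (simp only: append_Cons word_deriv_simps)
  also have "\<dots> = cdir (axis i 1) (word_deriv (j # a @ b) f) x"
    by (rule cdir_cong[OF S Cons.prems Cons.IH])
  also have "\<dots> = cdir (axis j 1) (cdir (axis i 1) (word_deriv (a @ b) f)) x"
    unfolding word_deriv_simps
    by (rule cdir_regularD(3)[OF cdir_regular_word_deriv[OF S f] Cons.prems])
  finally show ?case by (simp only: append_Cons word_deriv_simps)
qed simp

lemma word_deriv_mset_cong:
  assumes S: "open S" and f: "cdir_regular_on S f"
  shows "mset w = mset w' \<Longrightarrow> x \<in> S \<Longrightarrow> word_deriv w f x = word_deriv w' f x"
proof (induction w arbitrary: w' x)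
  case (Cons j w)
  from Cons.prems(1) have "j \<in> set w'" by (metis list.set_intros(1) set_mset_mset)
  then obtain a b where w': "w' = a @ j # b" by (meson split_list)
  with Cons.prems(1) have "mset w = mset (a @ b)" by simp
  then have "\<And>y. y \<in> S \<Longrightarrow> word_deriv w f y = word_deriv (a @ b) f y" by (rule Cons.IH)
  then have "word_deriv (j # w) f x = word_deriv (j # a @ b) f x"
    unfolding word_deriv_simps by (rule cdir_cong[OF S Cons.prems(2)])
  also have "\<dots> = word_deriv w' f x"
    unfolding w' by (rule word_deriv_move[OF S f Cons.prems(2), symmetric])
  finally show ?case .
qed simp

lemma cdir_lincomb:
  assumes "finite A" "\<And>i. i \<in> A \<Longrightarrow> \<exists>D. (k i has_derivative D) (at x)"
  shows "cdir v (\<lambda>x. \<Sum>i\<in>A. c i * k i x) x = (\<Sum>i\<in>A. c i * cdir v (k i) x)"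
proof -
  obtain D where D: "\<And>i. i \<in> A \<Longrightarrow> (k i has_derivative D i) (at x)"
    using assms(2) by metis
  have "((\<lambda>x. \<Sum>i\<in>A. c i * k i x) has_derivative (\<lambda>v. \<Sum>i\<in>A. c i * D i v)) (at x)"
    by (intro has_derivative_sum has_derivative_mult_right D)
  then have "cdir v (\<lambda>x. \<Sum>i\<in>A. c i * k i x) x
      = ((\<Sum>i\<in>A. c i * D i v) - \<i> * (\<Sum>i\<in>A. c i * D i (\<i> *s v))) / 2"
    by (rule cdir_eq)
  also have "\<dots> = (\<Sum>i\<in>A. c i * ((D i v - \<i> * D i (\<i> *s v)) / 2))"
    by (simp add: sum_distrib_left sum_subtractf[symmetric] sum_divide_distrib algebra_simps)
  also have "\<dots> = (\<Sum>i\<in>A. c i * cdir v (k i) x)"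
    by (intro sum.cong refl) (simp add: cdir_eq[OF D])
  finally show ?thesis .
qed

lemma vec_axis_expansion: "(\<theta> :: complex ^ 'n::finite) = (\<Sum>j\<in>UNIV. \<theta> $ j *s axis j 1)"
proof -
  have "(\<Sum>j\<in>UNIV. \<theta> $ j *s axis j 1) $ i = \<theta> $ i" for i
  proof -
    have "(\<Sum>j\<in>UNIV. \<theta> $ j *s axis j 1) $ i = (\<Sum>j\<in>UNIV. if j = i then \<theta> $ j else 0)"
      unfolding sum_component by (intro sum.cong refl) (simp add: axis_def)
    then show ?thesis by simp
  qed
  then show ?thesis by (simp add: vec_eq_iff)
qed

lemma cdir_power_expansion:
  fixes f :: "complex ^ 'n::finite \<Rightarrow> complex"
  assumes S: "open S" and f: "cdir_regular_on S f" and x: "x \<in> S"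
  shows "(cdir \<theta> ^^ m) f x = (\<Sum>w | length w = m. prod_list (map (($) \<theta>) w) * word_deriv w f x)"
  using x
proof (induction m arbitrary: x)
  case 0
  then show ?case by simp
next
  case (Suc m)
  have fin: "finite {w :: 'n list. length w = k}" for k
    using finite_lists_length_eq[of "UNIV :: 'n set" k] by simp
  have D: "\<exists>D. (word_deriv w f has_derivative D) (at x)" for w
    by (rule cdir_regularD(1)[OF cdir_regular_word_deriv[OF S f] Suc.prems])
  have "(cdir \<theta> ^^ Suc m) f x = cdir \<theta> (\<lambda>x. \<Sum>w | length w = m. prod_list (map (($) \<theta>) w) * word_deriv w f x) x"
    unfolding funpow.simps o_apply by (rule cdir_cong[OF S Suc.prems Suc.IH])
  also have "\<dots> = (\<Sum>w | length w = m. prod_list (map (($) \<theta>) w) * cdir \<theta> (word_deriv w f) x)"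
    by (rule cdir_lincomb[OF fin D])
  also have "\<dots> = (\<Sum>w | length w = m. \<Sum>j\<in>UNIV. prod_list (map (($) \<theta>) (j # w)) * word_deriv (j # w) f x)"
  proof (intro sum.cong refl)
    fix w :: "'n list"
    obtain D where "(word_deriv w f has_derivative D) (at x)" using D by blast
    from cdir_sum[OF this, of UNIV "($) \<theta>" "\<lambda>j. axis j 1"]
    have "cdir \<theta> (word_deriv w f) x = (\<Sum>j\<in>UNIV. \<theta> $ j * cdir (axis j 1) (word_deriv w f) x)"
      unfolding vec_axis_expansion[of \<theta>, symmetric] by simp
    then show "prod_list (map (($) \<theta>) w) * cdir \<theta> (word_deriv w f) x
        = (\<Sum>j\<in>UNIV. prod_list (map (($) \<theta>) (j # w)) * word_deriv (j # w) f x)"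
      by (simp add: sum_distrib_left mult_ac)
  qed
  also have "\<dots> = (\<Sum>(w, j)\<in>{w. length w = m} \<times> UNIV. prod_list (map (($) \<theta>) (j # w)) * word_deriv (j # w) f x)"
    by (rule sum.cartesian_product)
  also have "\<dots> = (\<Sum>w | length w = Suc m. prod_list (map (($) \<theta>) w) * word_deriv w f x)"
    by (rule sum.reindex_bij_witness[of _ "\<lambda>w. (tl w, hd w)" "\<lambda>(w, j). j # w"])
      (auto simp: length_Suc_conv)
  finally show ?case .
qed

lemma prod_list_map_count:
  fixes g :: "'n::finite \<Rightarrow> 'a::comm_monoid_mult"
  shows "prod_list (map g w) = (\<Prod>j\<in>UNIV. g j ^ count (mset w) j)"
proof (induction w)
  case (Cons i w)
  have "(\<Prod>j\<in>UNIV. g j ^ count (mset (i # w)) j) = (\<Prod>j\<in>UNIV. (if j = i then g j else 1) * g j ^ count (mset w) j)"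
    by (intro prod.cong) auto
  also have "\<dots> = g i * (\<Prod>j\<in>UNIV. g j ^ count (mset w) j)"
    by (simp add: prod.distrib prod.delta)
  finally show ?case using Cons.IH by simp
qed simp

lemma sum_roots_of_unity:
  assumes "k < N" "m < N"
  shows "(\<Sum>t<N. cis (2 * pi / real N) ^ (t * k) * cis (- (2 * pi / real N)) ^ (t * m)) = (if k = m then of_nat N else 0)"
proof -
  define q where "q = cis (2 * pi / real N * (real k - real m))"
  have N: "N > 0" using assms by simp
  have q: "cis (2 * pi / real N) ^ (t * k) * cis (- (2 * pi / real N)) ^ (t * m) = q ^ t" for t
    by (simp add: q_def Complex.DeMoivre cis_mult algebra_simps diff_divide_distrib)
  show ?thesis
  proof (cases "k = m")
    case True
    then have "q = 1" by (simp add: q_def)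
    with True show ?thesis unfolding q by simp
  next
    case False
    have "q \<noteq> 1"
    proof
      assume "q = 1"
      then obtain n :: int where "2 * pi / real N * (real k - real m) = of_int n * (2 * pi)"
        unfolding q_def cis_eq_1_iff by blast
      then have "(2 * pi) * (real k - real m) = (2 * pi) * (of_int n * real N)"
        using N by (simp add: field_simps)
      then have "real k - real m = of_int n * real N"
        by (subst (asm) mult_cancel_left) simp
      then have "of_int (int k - int m) = (of_int (n * int N) :: real)" by simp
      then have "int k - int m = n * int N" by (simp only: of_int_eq_iff)
      moreover have "\<bar>int k - int m\<bar> < int N" using assms by simp
      ultimately have "\<bar>n\<bar> * int N < 1 * int N" by (simp add: abs_mult)
      then have "n = 0" using N by (simp only: mult_less_cancel_right) auto
      with \<open>int k - int m = n * int N\<close> False show False by simp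
    qed
    moreover have "q ^ N = 1"
    proof -
      have "real N * (2 * pi / real N * (real k - real m)) = 2 * pi * (of_int (int k - int m))"
        using N by simp
      then show ?thesis unfolding q_def Complex.DeMoivre by (simp only: cis_multiple_2pi Ints_of_int)
    qed
    ultimately have "(\<Sum>t<N. q ^ t) = 0" by (simp add: geometric_sum)
    then show ?thesis using False by (simp only: q if_False)
  qed
qed

text \<open>Averaging over \<open>N\<close>-th roots of unity in each coordinate, with \<open>N\<close> exceeding the degree, annihilates every
monomial except the one with exponent \<open>mm\<close>.\<close>

lemma torus_average:
  fixes c :: "'n::finite list \<Rightarrow> complex" and r :: "'n \<Rightarrow> real" and mm :: "'n \<Rightarrow> nat"
  defines "M \<equiv> \<Sum>j\<in>UNIV. mm j"
  defines "N \<equiv> Suc M"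
  defines "\<omega> \<equiv> cis (2 * pi / real N)"
  shows "(\<Sum>t\<in>PiE UNIV (\<lambda>_::'n. {..<N}). (\<Prod>j\<in>UNIV. cnj \<omega> ^ (t j * mm j)) *
      (\<Sum>w | length w = M. prod_list (map (\<lambda>j. of_real (r j) * \<omega> ^ t j) w) * c w))
    = of_nat N ^ CARD('n) * (\<Prod>j\<in>UNIV. of_real (r j) ^ mm j) * (\<Sum>w | \<forall>j. count (mset w) j = mm j. c w)"
proof -
  have fin: "finite {w :: 'n list. length w = k}" for k
    using finite_lists_length_eq[of "UNIV :: 'n set" k] by simp
  have size: "length w = (\<Sum>j\<in>UNIV. count (mset w) j)" for w :: "'n list"
    unfolding size_mset[symmetric] size_multiset_overloaded_eq
    by (rule sum.mono_neutral_left) (auto simp: not_in_iff)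
  have cnt: "count (mset w) j < N" if "length w = M" for w j
    using that count_le_size[of "mset w" j] by (simp add: N_def)
  have mN: "mm j < N" for j
    using member_le_sum[of j UNIV mm] by (simp add: N_def M_def)
  have cnj\<omega>: "cnj \<omega> = cis (- (2 * pi / real N))" by (simp add: \<omega>_def cis_cnj)
  have one: "(\<Sum>t\<in>PiE UNIV (\<lambda>_::'n. {..<N}). (\<Prod>j\<in>UNIV. cnj \<omega> ^ (t j * mm j)) * prod_list (map (\<lambda>j. of_real (r j) * \<omega> ^ t j) w))
      = (if \<forall>j. count (mset w) j = mm j then of_nat N ^ CARD('n) * (\<Prod>j\<in>UNIV. of_real (r j) ^ mm j) else 0)"
    if w: "length w = M" for w
  proof -
    let ?k = "count (mset w)"
    have "(\<Sum>t\<in>PiE UNIV (\<lambda>_::'n. {..<N}). (\<Prod>j\<in>UNIV. cnj \<omega> ^ (t j * mm j)) * prod_list (map (\<lambda>j. of_real (r j) * \<omega> ^ t j) w))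
        = (\<Sum>t\<in>PiE UNIV (\<lambda>_::'n. {..<N}). (\<Prod>j\<in>UNIV. of_real (r j) ^ ?k j * (\<omega> ^ (t j * ?k j) * cnj \<omega> ^ (t j * mm j))))"
      by (intro sum.cong refl)
        (simp add: prod_list_map_count prod.distrib[symmetric] power_mult_distrib power_mult mult_ac)
    also have "\<dots> = (\<Prod>j\<in>UNIV. \<Sum>t<N. of_real (r j) ^ ?k j * (\<omega> ^ (t * ?k j) * cnj \<omega> ^ (t * mm j)))"
      by (rule prod_sum_PiE[symmetric]) auto
    also have "\<dots> = (\<Prod>j\<in>UNIV. of_real (r j) ^ ?k j * (if ?k j = mm j then of_nat N else 0))"
      unfolding sum_distrib_left[symmetric] cnj\<omega> unfolding \<omega>_def
      by (simp only: sum_roots_of_unity[OF cnt[OF w] mN])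
    also have "\<dots> = (if \<forall>j. ?k j = mm j then of_nat N ^ CARD('n) * (\<Prod>j\<in>UNIV. of_real (r j) ^ mm j) else 0)"
    proof (cases "\<forall>j. ?k j = mm j")
      case True
      then show ?thesis by (simp add: prod.distrib mult.commute)
    next
      case False
      then show ?thesis by (auto simp: prod_zero_iff)
    qed
    finally show ?thesis .
  qed
  have "(\<Sum>t\<in>PiE UNIV (\<lambda>_::'n. {..<N}). (\<Prod>j\<in>UNIV. cnj \<omega> ^ (t j * mm j)) *
      (\<Sum>w | length w = M. prod_list (map (\<lambda>j. of_real (r j) * \<omega> ^ t j) w) * c w))
      = (\<Sum>w | length w = M. (\<Sum>t\<in>PiE UNIV (\<lambda>_::'n. {..<N}). (\<Prod>j\<in>UNIV. cnj \<omega> ^ (t j * mm j)) * prod_list (map (\<lambda>j. of_real (r j) * \<omega> ^ t j) w)) * c w)"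
    by (simp only: sum_distrib_left sum_distrib_right mult.assoc) (rule sum.swap)
  also have "\<dots> = (\<Sum>w | length w = M. (if \<forall>j. count (mset w) j = mm j then of_nat N ^ CARD('n) * (\<Prod>j\<in>UNIV. of_real (r j) ^ mm j) else 0) * c w)"
    by (intro sum.cong refl) (simp only: one mem_Collect_eq)
  also have "\<dots> = (\<Sum>w | \<forall>j. count (mset w) j = mm j. of_nat N ^ CARD('n) * (\<Prod>j\<in>UNIV. of_real (r j) ^ mm j) * c w)"
    by (rule sum.mono_neutral_cong_right[OF fin]) (auto simp: size M_def)
  finally show ?thesis by (simp add: sum_distrib_left)
qed

text \<open>The multinomial coefficient.\<close>

lemma card_words:
  fixes mm :: "'n::finite \<Rightarrow> nat" and w0 :: "'n list"
  assumes w0: "\<And>j. count (mset w0) j = mm j"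
  shows "card {w. \<forall>j. count (mset w) j = mm j} * (\<Prod>j\<in>UNIV. fact (mm j)) = fact (\<Sum>j\<in>UNIV. mm j)"
proof -
  have zero: "mm i = 0" if "i \<notin> set w0" for i
    using w0[of i] that by (simp add: count_mset_0_iff[symmetric] del: count_mset_0_iff)
  have "{w. \<forall>j. count (mset w) j = mm j} = permutations_of_multiset (mset w0)"
    by (auto simp: permutations_of_multiset_def multiset_eq_iff w0)
  moreover have "(\<Prod>j\<in>UNIV. fact (mm j)) = (\<Prod>x\<in>set_mset (mset w0). fact (count (mset w0) x) :: nat)"
    by (rule prod.mono_neutral_cong_right) (auto simp: w0 zero)
  moreover have "(\<Sum>j\<in>UNIV. mm j) = size (mset w0)"
    unfolding size_multiset_overloaded_eq
    by (rule sum.mono_neutral_cong_right) (auto simp: w0 zero)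
  ultimately show ?thesis using card_permutations_of_multiset_aux[of "mset w0"] by simp
qed

text \<open>The averages for \<open>f\<close> and \<open>g\<close> run over the same points of the torus, so a bound on the sum of the two
directional derivatives passes to the sum of the two coefficients.\<close>

lemma coefficient_bound_from_torus:
  fixes f g :: "complex ^ 'n::finite \<Rightarrow> complex" and r :: "'n \<Rightarrow> real"
  assumes S: "open S" and f: "cdir_regular_on S f" and g: "cdir_regular_on S g" and z: "z \<in> S"
    and r: "\<And>j. r j \<ge> 0"
    and w0: "\<And>j. count (mset w0) j = mm j" and M: "M = (\<Sum>j\<in>UNIV. mm j)"
    and bd: "\<And>\<theta>. (\<And>j. norm (\<theta> $ j) = r j) \<Longrightarrow> norm ((cdir \<theta> ^^ M) f z) + norm ((cdir \<theta> ^^ M) g z) \<le> K"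
  shows "(\<Prod>j\<in>UNIV. r j ^ mm j) * fact M * (norm (word_deriv w0 f z) + norm (word_deriv w0 g z))
       \<le> K * (\<Prod>j\<in>UNIV. fact (mm j))"
proof -
  define N where "N = Suc M"
  define \<omega> where "\<omega> = cis (2 * pi / real N)"
  define T where "T = PiE UNIV (\<lambda>_::'n. {..<N})"
  define \<theta> where "\<theta> = (\<lambda>t::'n \<Rightarrow> nat. \<chi> j. of_real (r j) * \<omega> ^ t j)"
  define P where "P = (\<Prod>j\<in>UNIV. r j ^ mm j)"
  define W where "W = {w :: 'n list. \<forall>j. count (mset w) j = mm j}"
  have P: "P \<ge> 0" using r by (auto simp: P_def intro!: prod_nonneg)
  have \<omega>: "norm \<omega> = 1" by (simp add: \<omega>_def)
  have finT: "finite T" by (auto simp: T_def intro!: finite_PiE)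
  have cardT: "card T = N ^ CARD('n)" by (simp add: T_def card_PiE)
  have main: "real N ^ CARD('n) * P * real (card W) * norm (word_deriv w0 k z) \<le> (\<Sum>t\<in>T. norm ((cdir (\<theta> t) ^^ M) k z))"
    if k: "cdir_regular_on S k" for k
  proof -
    have "(\<Sum>w\<in>W. word_deriv w k z) = (\<Sum>w\<in>W. word_deriv w0 k z)"
      by (intro sum.cong refl word_deriv_mset_cong[OF S k _ z]) (auto simp: W_def multiset_eq_iff w0)
    then have Wk: "(\<Sum>w\<in>W. word_deriv w k z) = of_nat (card W) * word_deriv w0 k z" by simp
    have pw: "prod_list (map (($) (\<theta> t)) w) = prod_list (map (\<lambda>j. of_real (r j) * \<omega> ^ t j) w)" for t w
      by (rule arg_cong[where f = prod_list]) (simp add: \<theta>_def)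
    have "(\<Sum>t\<in>T. (\<Prod>j\<in>UNIV. cnj \<omega> ^ (t j * mm j)) * (cdir (\<theta> t) ^^ M) k z)
       = of_nat N ^ CARD('n) * (\<Prod>j\<in>UNIV. of_real (r j) ^ mm j) * (\<Sum>w\<in>W. word_deriv w k z)"
      unfolding cdir_power_expansion[OF S k z] pw T_def W_def \<omega>_def N_def M
      by (rule torus_average)
    also have "\<dots> = of_real (real N ^ CARD('n) * P * real (card W)) * word_deriv w0 k z"
      by (simp add: Wk P_def)
    finally have "norm (of_real (real N ^ CARD('n) * P * real (card W)) * word_deriv w0 k z)
        = norm (\<Sum>t\<in>T. (\<Prod>j\<in>UNIV. cnj \<omega> ^ (t j * mm j)) * (cdir (\<theta> t) ^^ M) k z)"
      by simp
    also have "\<dots> \<le> (\<Sum>t\<in>T. norm ((\<Prod>j\<in>UNIV. cnj \<omega> ^ (t j * mm j)) * (cdir (\<theta> t) ^^ M) k z))"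
      by (rule norm_sum)
    also have "\<dots> = (\<Sum>t\<in>T. norm ((cdir (\<theta> t) ^^ M) k z))"
      by (intro sum.cong refl) (simp add: norm_mult norm_power prod_norm[symmetric] \<omega>)
    finally show ?thesis using P by (simp add: norm_mult norm_power abs_mult)
  qed
  have "real N ^ CARD('n) * (P * real (card W) * (norm (word_deriv w0 f z) + norm (word_deriv w0 g z)))
      \<le> (\<Sum>t\<in>T. norm ((cdir (\<theta> t) ^^ M) f z) + norm ((cdir (\<theta> t) ^^ M) g z))"
    using main[OF f] main[OF g] by (simp add: sum.distrib algebra_simps)
  also have "\<dots> \<le> (\<Sum>t\<in>T. K)"
    by (intro sum_mono bd) (use r in \<open>simp add: \<theta>_def norm_mult norm_power \<omega>\<close>)
  also have "\<dots> = real N ^ CARD('n) * K" by (simp add: cardT)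
  finally have *: "P * real (card W) * (norm (word_deriv w0 f z) + norm (word_deriv w0 g z)) \<le> K"
    by (simp add: N_def)
  have "real (card W * (\<Prod>j\<in>UNIV. fact (mm j))) = real (fact M)"
    unfolding W_def M by (subst card_words[OF w0]) simp
  then have cw: "real (card W) * (\<Prod>j\<in>UNIV. fact (mm j)) = fact M" by simp
  have "P * real (card W) * (norm (word_deriv w0 f z) + norm (word_deriv w0 g z)) * (\<Prod>j\<in>UNIV. fact (mm j))
      \<le> K * (\<Prod>j\<in>UNIV. fact (mm j))"
    by (intro mult_right_mono * prod_nonneg) auto
  then show ?thesis by (simp add: P_def cw[symmetric] mult_ac)
qed

section \<open>The estimate in a fixed direction\<close>

lemma norm_vec_sq: "(norm (x :: complex ^ 'n::finite))\<^sup>2 = (\<Sum>j\<in>UNIV. (norm (x $ j))\<^sup>2)"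
  by (simp add: norm_vec_def L2_set_def sum_nonneg)

lemma norm_add_vscale_sq:
  fixes x y :: "complex ^ 'n::finite"
  shows "(norm (x + c *s y))\<^sup>2 = (norm x)\<^sup>2 + 2 * Re (cnj c * (\<Sum>j\<in>UNIV. x $ j * cnj (y $ j))) + (norm c)\<^sup>2 * (norm y)\<^sup>2"
proof -
  have "(norm (a + c * b))\<^sup>2 = (norm a)\<^sup>2 + 2 * Re (cnj c * (a * cnj b)) + (norm c)\<^sup>2 * (norm b)\<^sup>2" for a b
    unfolding cmod_power2 by (simp add: power2_eq_square algebra_simps)
  then show ?thesis
    by (simp add: norm_vec_sq sum.distrib sum_distrib_left)
qed

text \<open>The line through \<open>z\<close> in direction \<open>\<theta>\<close> meets the ball in a disc with centre \<open>a\<close>, the point of the line closest to the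
origin, and of radius \<open>R\<close>, where \<open>R\<^sup>2 = 1 - \<parallel>a\<parallel>\<^sup>2\<close>. In the parameter \<open>\<zeta>\<close> normalized to the unit disc one has
\<open>R\<^sup>2 (1 - \<bar>\<zeta>\<bar>\<^sup>2) = 1 - \<parallel>z\<parallel>\<^sup>2\<close>, so the bound on the disc takes the stated form.\<close>

lemma direction_derivative_bound:
  fixes f :: "complex ^ 'n::finite \<Rightarrow> complex"
  assumes f: "levi_flat_on (ball 0 1) f" and bd: "\<And>x. x \<in> ball 0 1 \<Longrightarrow> norm (f x) \<le> 1"
    and z: "norm z < 1" and m: "m \<ge> 1" and \<theta>: "\<theta> \<noteq> 0"
  shows "norm ((cdir \<theta> ^^ m) f z) + norm ((cdir \<theta> ^^ m) (\<lambda>x. cnj (f x)) z)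
    \<le> 4 / pi * fact m * (norm \<theta> * (norm \<theta> + norm (\<Sum>j\<in>UNIV. z $ j * cnj (\<theta> $ j))) ^ (m - 1) / (1 - (norm z)\<^sup>2) ^ m)"
proof -
  define c where "c = (\<Sum>j\<in>UNIV. z $ j * cnj (\<theta> $ j))"
  define \<rho> where "\<rho> = norm \<theta>"
  have \<rho>: "\<rho> > 0" using \<theta> by (simp add: \<rho>_def)
  define s where "s = 1 - (norm z)\<^sup>2"
  have s: "s > 0" using z by (simp add: s_def power_less_one_iff)
  define R where "R = sqrt (s + (norm c)\<^sup>2 / \<rho>\<^sup>2)"
  have R: "R > 0" using s by (simp add: R_def add_pos_nonneg)
  have R2: "R\<^sup>2 = s + (norm c)\<^sup>2 / \<rho>\<^sup>2" using s by (simp add: R_def)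
  define c' where "c' = c / of_real (\<rho>\<^sup>2)"
  define a where "a = z - c' *s \<theta>"
  define v where "v = (R / \<rho>) *\<^sub>R \<theta>"
  define \<zeta> where "\<zeta> = c / of_real (\<rho> * R)"
  have n\<zeta>: "norm \<zeta> = norm c / (\<rho> * R)" using \<rho> R by (simp add: \<zeta>_def norm_divide norm_mult)
  have line: "(norm (z + (t - c') *s \<theta>))\<^sup>2 = (norm z)\<^sup>2 - (norm c)\<^sup>2 / \<rho>\<^sup>2 + (norm t)\<^sup>2 * \<rho>\<^sup>2" for t
  proof -
    have c: "c = of_real (\<rho>\<^sup>2) * c'" using \<rho> by (simp add: c'_def)
    have nc: "(norm c)\<^sup>2 / \<rho>\<^sup>2 = \<rho>\<^sup>2 * (norm c')\<^sup>2"
      using \<rho> by (simp add: c norm_mult power2_eq_square)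
    have "2 * Re (cnj (t - c') * (of_real (\<rho>\<^sup>2) * c')) + (norm (t - c'))\<^sup>2 * \<rho>\<^sup>2
        = \<rho>\<^sup>2 * (2 * Re (cnj (t - c') * c') + (norm (t - c'))\<^sup>2)"
      by (simp add: algebra_simps)
    also have "2 * Re (cnj (t - c') * c') + (norm (t - c'))\<^sup>2 = (norm t)\<^sup>2 - (norm c')\<^sup>2"
      unfolding cmod_power2 by (simp add: power2_eq_square algebra_simps)
    finally have "2 * Re (cnj (t - c') * c) + (norm (t - c'))\<^sup>2 * \<rho>\<^sup>2
        = \<rho>\<^sup>2 * ((norm t)\<^sup>2 - (norm c')\<^sup>2)"
      by (simp only: c[symmetric])
    then show ?thesis
      unfolding norm_add_vscale_sq c_def[symmetric] \<rho>_def[symmetric] nc by (simp add: algebra_simps)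
  qed
  have nonneg: "(norm c)\<^sup>2 / \<rho>\<^sup>2 \<le> (norm z)\<^sup>2"
    using line[of 0] zero_le_power2[of "norm (z + (0 - c') *s \<theta>)"] by simp
  have R1: "R \<le> 1"
  proof -
    have "R\<^sup>2 \<le> 1\<^sup>2" using nonneg by (simp add: R2 s_def)
    then show ?thesis by (rule power2_le_imp_le) simp
  qed
  have av: "a + \<xi> *s v = z + (\<xi> * of_real (R / \<rho>) - c') *s \<theta>" for \<xi>
    unfolding a_def v_def scaleR_vec_complex by (simp add: vec_eq_iff algebra_simps)
  have sub: "a + \<xi> *s v \<in> ball 0 1" if "norm \<xi> < 1" for \<xi>
  proof -
    have "(norm (\<xi> * of_real (R / \<rho>)))\<^sup>2 * \<rho>\<^sup>2 = (norm \<xi>)\<^sup>2 * R\<^sup>2"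
      using \<rho> R by (simp add: norm_mult norm_divide power_mult_distrib power_divide)
    moreover have "(norm \<xi>)\<^sup>2 * R\<^sup>2 < 1 * R\<^sup>2"
      using that R by (intro mult_strict_right_mono) (auto simp: power_less_one_iff)
    ultimately have "(norm (a + \<xi> *s v))\<^sup>2 < (norm z)\<^sup>2 - (norm c)\<^sup>2 / \<rho>\<^sup>2 + R\<^sup>2"
      unfolding av line by simp
    then have "(norm (a + \<xi> *s v))\<^sup>2 < 1\<^sup>2" by (simp add: R2 s_def)
    then have "norm (a + \<xi> *s v) < 1" by (rule power2_less_imp_less) simp
    then show ?thesis by simp
  qed
  have a\<zeta>: "a + \<zeta> *s v = z"
  proof -
    have "\<zeta> * of_real (R / \<rho>) = c'"
      using R \<rho> by (simp add: \<zeta>_def c'_def power2_eq_square)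
    then show ?thesis by (simp add: av)
  qed
  have one: "1 - (norm \<zeta>)\<^sup>2 = s / R\<^sup>2"
  proof -
    have "(norm \<zeta>)\<^sup>2 * R\<^sup>2 = (norm c)\<^sup>2 / \<rho>\<^sup>2"
      using R by (simp add: n\<zeta> power_divide power_mult_distrib)
    then have "(1 - (norm \<zeta>)\<^sup>2) * R\<^sup>2 = s" by (simp add: R2 left_diff_distrib)
    then show ?thesis using R by (simp add: field_simps)
  qed
  have \<zeta>1: "norm \<zeta> < 1"
  proof -
    have "s / R\<^sup>2 > 0" using s R by simp
    then have "(norm \<zeta>)\<^sup>2 < 1\<^sup>2" unfolding one[symmetric] by simp
    then show ?thesis by (rule power2_less_imp_less) simp
  qed
  have scale: "(cdir v ^^ m) k z = of_real ((R / \<rho>) ^ m) * (cdir \<theta> ^^ m) k z" if k: "levi_flat_on (ball 0 1) k" for k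
  proof -
    have reg: "cdir_regular_on (ball 0 1) k" by (rule levi_flat_imp_cdir_regular[OF open_ball k])
    have zb: "z \<in> ball 0 1" using z by simp
    have "prod_list (map (($) v) w) = of_real ((R / \<rho>) ^ length w) * prod_list (map (($) \<theta>) w)" for w
      unfolding v_def scaleR_vec_complex by (induction w) auto
    then show ?thesis
      unfolding cdir_power_expansion[OF open_ball reg zb] by (simp add: sum_distrib_left mult.assoc)
  qed
  define X where "X = norm ((cdir \<theta> ^^ m) f z) + norm ((cdir \<theta> ^^ m) (\<lambda>x. cnj (f x)) z)"
  have "norm ((cdir v ^^ m) f z) + norm ((cdir v ^^ m) (\<lambda>x. cnj (f x)) z) = (R / \<rho>) ^ m * X"
    using R \<rho> unfolding scale[OF f] scale[OF levi_flat_cnj[OF f]] X_def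
    by (simp only: norm_mult norm_of_real distrib_left) simp
  with line_derivative_bound[OF open_ball f bd sub m \<zeta>1]
  have "(R / \<rho>) ^ m * X \<le> 4 / pi * fact m * ((1 + norm \<zeta>) ^ (m - 1) / (s / R\<^sup>2) ^ m)"
    by (simp add: a\<zeta> one)
  then have "(\<rho> / R) ^ m * ((R / \<rho>) ^ m * X) \<le> (\<rho> / R) ^ m * (4 / pi * fact m * ((1 + norm \<zeta>) ^ (m - 1) / (s / R\<^sup>2) ^ m))"
    using R \<rho> by (intro mult_left_mono) auto
  also have "(\<rho> / R) ^ m * ((R / \<rho>) ^ m * X) = X"
    using R \<rho> by (simp add: power_divide)
  also have "(\<rho> / R) ^ m * (4 / pi * fact m * ((1 + norm \<zeta>) ^ (m - 1) / (s / R\<^sup>2) ^ m))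
      = 4 / pi * fact m * ((\<rho> * R) ^ m * (1 + norm \<zeta>) ^ (m - 1) / s ^ m)"
  proof -
    have "(\<rho> / R) / (s / R\<^sup>2) = \<rho> * R / s" using R by (simp add: power2_eq_square)
    then have 1: "(\<rho> / R) ^ m / (s / R\<^sup>2) ^ m = (\<rho> * R) ^ m / s ^ m" by (simp only: power_divide[symmetric])
    have 2: "p * (x * (b / d)) = x * (p / d * b)" for p x b d :: real by simp
    show ?thesis unfolding 2 1 by (simp only: times_divide_eq_left)
  qed
  also have "(\<rho> * R) ^ m * (1 + norm \<zeta>) ^ (m - 1) = \<rho> * R * (\<rho> * R + norm c) ^ (m - 1)"
  proof -
    have "(\<rho> * R) * (1 + norm \<zeta>) = \<rho> * R + norm c"
      using R \<rho> by (simp add: n\<zeta> distrib_left)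
    then have "(\<rho> * R) ^ (m - 1) * (1 + norm \<zeta>) ^ (m - 1) = (\<rho> * R + norm c) ^ (m - 1)"
      by (metis power_mult_distrib)
    moreover have "(\<rho> * R) ^ m = \<rho> * R * (\<rho> * R) ^ (m - 1)"
      using m by (cases m) auto
    ultimately show ?thesis by (simp add: mult.assoc)
  qed
  also have "4 / pi * fact m * (\<rho> * R * (\<rho> * R + norm c) ^ (m - 1) / s ^ m)
      \<le> 4 / pi * fact m * (\<rho> * (\<rho> + norm c) ^ (m - 1) / s ^ m)"
  proof -
    have "\<rho> * R \<le> \<rho>" using R1 \<rho> by (simp add: mult_left_le)
    then have "\<rho> * R * (\<rho> * R + norm c) ^ (m - 1) \<le> \<rho> * (\<rho> + norm c) ^ (m - 1)"
      using R \<rho> by (intro mult_mono power_mono) auto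
    then show ?thesis using s by (intro mult_left_mono divide_right_mono) auto
  qed
  finally show ?thesis by (simp add: X_def \<rho>_def c_def s_def)
qed

section \<open>The largest multinomial term\<close>

text \<open>The quotient of consecutive terms is \<open>m / (k + 1)\<close>: the sequence increases up to \<open>k = m\<close> and decreases afterwards.\<close>

lemma power_div_fact_le_diagonal: "real m ^ k / fact k \<le> real m ^ m / fact m"
proof (cases "k \<le> m")
  case True
  then show ?thesis
  proof (induction k rule: inc_induct)
    case (step n)
    have "(real m ^ n / fact n) * 1 \<le> (real m ^ n / fact n) * (real m / real (Suc n))"
      using step.hyps by (intro mult_left_mono) auto
    also have "\<dots> = real m ^ Suc n / fact (Suc n)" by (simp add: mult_ac)
    finally show ?case using step.IH by simp
  qed simp
next
  case False
  then have "m \<le> k" by simp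
  then show ?thesis
  proof (induction k rule: dec_induct)
    case (step n)
    have "real m ^ Suc n / fact (Suc n) = (real m ^ n / fact n) * (real m / real (Suc n))" by (simp add: mult_ac)
    also have "\<dots> \<le> (real m ^ n / fact n) * 1"
      using step.hyps by (intro mult_left_mono) auto
    finally show ?case using step.IH by simp
  qed simp
qed

lemma exp_term_add: "(x + y :: real) ^ n / fact n = (\<Sum>i\<le>n. (x ^ i / fact i) * (y ^ (n - i) / fact (n - i)))"
  unfolding binomial_ring sum_divide_distrib
  by (intro sum.cong refl) (simp add: binomial_fact)

lemma sum_choose_multisets: "(\<Sum>i\<le>n. (c + i - 1) choose i) = (c + n) choose n"
proof (cases c)
  case 0
  have "(\<Sum>i\<le>n. (i - 1) choose i) = (\<Sum>i\<le>n. if i = 0 then 1 else 0)"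
    by (intro sum.cong) auto
  with 0 show ?thesis by simp
next
  case (Suc d)
  then show ?thesis using sum_choose_lower[of d n] by simp
qed

text \<open>The multinomial expansion of the left side has \<open>(card A + n - 1 choose n)\<close> terms, each at most \<open>\<Prod> K j\<close>. The induction
splits off one variable by the binomial theorem and counts terms by the hockey-stick identity.\<close>

lemma power_sum_div_fact_le:
  fixes a K :: "'a \<Rightarrow> real"
  assumes "finite A" "\<And>j. j \<in> A \<Longrightarrow> a j \<ge> 0" "\<And>j k. j \<in> A \<Longrightarrow> a j ^ k / fact k \<le> K j"
  shows "(\<Sum>j\<in>A. a j) ^ n / fact n \<le> real ((card A + n - 1) choose n) * (\<Prod>j\<in>A. K j)"
  using assms
proof (induction A arbitrary: n rule: finite_induct)
  case empty
  then show ?case by (cases n) auto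
next
  case (insert x A)
  have K0: "K j \<ge> 0" if "j \<in> insert x A" for j
    using insert.prems(1)[OF that] insert.prems(2)[OF that, of 0] by simp
  have "(\<Sum>j\<in>insert x A. a j) ^ n / fact n = (\<Sum>i\<le>n. ((\<Sum>j\<in>A. a j) ^ i / fact i) * (a x ^ (n - i) / fact (n - i)))"
    using insert.hyps exp_term_add[of "\<Sum>j\<in>A. a j" "a x" n] by (simp add: add.commute)
  also have "\<dots> \<le> (\<Sum>i\<le>n. (real ((card A + i - 1) choose i) * (\<Prod>j\<in>A. K j)) * K x)"
    using insert.prems K0 by (intro sum_mono mult_mono insert.IH) (auto intro!: prod_nonneg mult_nonneg_nonneg)
  also have "\<dots> = real (\<Sum>i\<le>n. (card A + i - 1) choose i) * (\<Prod>j\<in>insert x A. K j)"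
    unfolding sum_distrib_right[symmetric] using insert.hyps by (simp add: mult_ac)
  also have "\<dots> = real ((card (insert x A) + n - 1) choose n) * (\<Prod>j\<in>insert x A. K j)"
    using insert.hyps unfolding sum_choose_multisets by simp
  finally show ?case .
qed

section \<open>The extremal function\<close>

text \<open>The affine argument \<open>p + L x\<close> covers both a coordinate function on the ball and its restriction to a line.\<close>

lemma C2_on_two_re:
  fixes L :: "'a::real_normed_vector \<Rightarrow> complex"
  assumes h: "h holomorphic_on U" and U: "open U" and L: "bounded_linear L"
    and S: "\<And>x. x \<in> S \<Longrightarrow> p + L x \<in> U"
  shows "C2_on S (\<lambda>x. h (p + L x) + cnj (h (p + L x)))"
proof -
  define T where "T = Blinfun (\<lambda>c. c + cnj c)"
  have bT: "bounded_linear (\<lambda>c. c + cnj c)"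
    by (intro bounded_linear_add bounded_linear_ident bounded_linear_cnj)
  have T: "blinfun_apply T = (\<lambda>c. c + cnj c)" by (simp add: T_def bounded_linear_Blinfun_apply bT)
  define Lb where "Lb = Blinfun L"
  have Lb: "blinfun_apply Lb = L" by (simp add: Lb_def bounded_linear_Blinfun_apply L)
  define \<Phi> where "\<Phi> = (\<lambda>c. T o\<^sub>L (blinfun_mult_right c o\<^sub>L Lb))"
  have b\<Phi>: "bounded_linear \<Phi>"
    unfolding \<Phi>_def
    by (intro bounded_linear_compose[OF bounded_bilinear.bounded_linear_right[OF bounded_bilinear_blinfun_compose]]
        bounded_linear_compose[OF bounded_bilinear.bounded_linear_left[OF bounded_bilinear_blinfun_compose]]
        bounded_linear_blinfun_mult_right)
  define \<Phi>b where "\<Phi>b = Blinfun \<Phi>"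
  have \<Phi>b: "blinfun_apply \<Phi>b = \<Phi>" by (simp add: \<Phi>b_def bounded_linear_Blinfun_apply b\<Phi>)
  have A: "((\<lambda>x. p + L x) has_derivative L) (at x)" for x
    using has_derivative_add[OF has_derivative_const[of p] bounded_linear_imp_has_derivative[OF L]] by simp
  have comp: "((\<lambda>x. k (p + L x)) has_derivative (\<lambda>v. deriv k (p + L x) * L v)) (at x)"
    if "k holomorphic_on U" "x \<in> S" for k x
    using has_derivative_compose[OF A holomorphic_derivI[OF that(1) U S[OF that(2)], unfolded has_field_derivative_def]]
    by simp
  define f' where "f' = (\<lambda>x. \<Phi> (deriv h (p + L x)))"
  define f'' where "f'' = (\<lambda>x. \<Phi>b o\<^sub>L (blinfun_mult_right (deriv (deriv h) (p + L x)) o\<^sub>L Lb))"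
  have dh: "deriv h holomorphic_on U" and ddh: "deriv (deriv h) holomorphic_on U"
    using holomorphic_deriv[OF h U] holomorphic_deriv[OF holomorphic_deriv[OF h U] U] by auto
  show ?thesis unfolding C2_on_def
  proof (intro exI[of _ f'] exI[of _ f''] conjI ballI)
    fix x assume x: "x \<in> S"
    have "blinfun_apply (f' x) = (\<lambda>v. deriv h (p + L x) * L v + cnj (deriv h (p + L x) * L v))"
      by (simp add: fun_eq_iff f'_def \<Phi>_def T Lb)
    then show "((\<lambda>x. h (p + L x) + cnj (h (p + L x))) has_derivative blinfun_apply (f' x)) (at x)"
      using has_derivative_add[OF comp[OF h x] bounded_linear.has_derivative[OF bounded_linear_cnj comp[OF h x]]]
      by (simp only:)
    have "blinfun_apply (f'' x) = (\<lambda>v. \<Phi> (deriv (deriv h) (p + L x) * L v))"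
      by (simp add: fun_eq_iff f''_def \<Phi>b Lb)
    then show "(f' has_derivative blinfun_apply (f'' x)) (at x)"
      using bounded_linear.has_derivative[OF b\<Phi> comp[OF dh x]] unfolding f'_def by (simp only:)
  next
    have cA: "continuous_on S (\<lambda>x. p + L x)"
      by (intro continuous_on_add continuous_on_const linear_continuous_on L)
    have "continuous_on S (\<lambda>x. deriv (deriv h) (p + L x))"
      by (rule continuous_on_compose2[OF holomorphic_on_imp_continuous_on[OF ddh] cA]) (use S in auto)
    then have 1: "continuous_on S (\<lambda>x. blinfun_mult_right (deriv (deriv h) (p + L x)))"
      by (rule bounded_linear.continuous_on[OF bounded_linear_blinfun_mult_right])
    have 2: "continuous_on S (\<lambda>x. blinfun_mult_right (deriv (deriv h) (p + L x)) o\<^sub>L Lb)"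
      by (rule bounded_bilinear.continuous_on[OF bounded_bilinear_blinfun_compose 1 continuous_on_const])
    show "continuous_on S f''"
      unfolding f''_def
      by (rule bounded_bilinear.continuous_on[OF bounded_bilinear_blinfun_compose continuous_on_const 2])
  qed
qed

lemma laplacian_two_re:
  assumes F: "F holomorphic_on U" and U: "open U" and \<zeta>: "\<zeta> \<in> U"
  defines "g \<equiv> (\<lambda>\<zeta>. F \<zeta> + cnj (F \<zeta>))"
  shows "dir_deriv 1 (dir_deriv 1 g) \<zeta> + dir_deriv \<i> (dir_deriv \<i> g) \<zeta> = 0"
proof -
  have step: "dir_deriv c (\<lambda>\<zeta>. b * k \<zeta> + cnj (b * k \<zeta>)) x = (b * c) * deriv k x + cnj ((b * c) * deriv k x)"
    if k: "k holomorphic_on U" and x: "x \<in> U" for b c k x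
  proof -
    have "(k has_derivative (*) (deriv k x)) (at x)"
      using holomorphic_derivI[OF k U x] by (simp add: has_field_derivative_def)
    then have d: "((\<lambda>\<zeta>. b * k \<zeta>) has_derivative (\<lambda>\<eta>. b * (deriv k x * \<eta>))) (at x)"
      by (rule has_derivative_mult_right)
    from dir_deriv_eq[OF has_derivative_add[OF d bounded_linear.has_derivative[OF bounded_linear_cnj d]]]
    show ?thesis by (simp add: mult_ac)
  qed
  have dF: "deriv F holomorphic_on U" by (rule holomorphic_deriv[OF F U])
  have "dir_deriv c (dir_deriv c g) \<zeta> = (c * c) * deriv (deriv F) \<zeta> + cnj ((c * c) * deriv (deriv F) \<zeta>)" for c
  proof -
    have "dir_deriv c (dir_deriv c g) \<zeta> = dir_deriv c (\<lambda>\<zeta>. c * deriv F \<zeta> + cnj (c * deriv F \<zeta>)) \<zeta>"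
      using step[OF F, of _ c 1] by (intro dir_deriv_cong[OF U \<zeta>]) (simp add: g_def)
    then show ?thesis by (simp only: step[OF dF \<zeta>])
  qed
  from this[of 1] this[of \<i>] show ?thesis by simp
qed

text \<open>A segment leaving \<open>S\<close> crosses the frontier of \<open>S\<close>.\<close>

lemma within_boundary_dist:
  fixes z :: "'a::real_normed_vector"
  assumes "z \<in> S" "ereal (norm v) < boundary_dist S z"
  shows "z + v \<in> S"
proof (rule ccontr)
  assume "z + v \<notin> S"
  then have "closed_segment z (z + v) \<inter> frontier S \<noteq> {}"
    using assms(1) by (intro connected_Int_frontier) auto
  then obtain w where w: "w \<in> closed_segment z (z + v)" "w \<in> frontier S" by blast
  have "dist z w \<le> norm v"
    using segment_bound(1)[OF w(1)] by (simp add: dist_norm norm_minus_commute)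
  moreover have "boundary_dist S z \<le> ereal (dist z w)"
    unfolding boundary_dist_def by (rule INF_lower[OF w(2)])
  ultimately show False using assms(2) by (meson ereal_less_eq(3) leD order_trans)
qed

lemma pluriharmonic_two_re:
  fixes j :: "'n::finite"
  assumes h: "h holomorphic_on ball 0 1"
  shows "pluriharmonic_on (ball 0 1) (\<lambda>z :: complex ^ 'n. h (z $ j) + cnj (h (z $ j)))"
  unfolding pluriharmonic_on_def
proof (intro conjI ballI allI impI)
  have comp_lt: "z $ j \<in> ball 0 1" if "z \<in> ball 0 1" for z :: "complex ^ 'n"
    using that Finite_Cartesian_Product.norm_nth_le[of z j] by simp
  show "C2_on (ball 0 1) (\<lambda>z :: complex ^ 'n. h (z $ j) + cnj (h (z $ j)))"
    using C2_on_two_re[OF h open_ball bounded_linear_vec_nth, of "ball 0 1" 0 j] comp_lt by simp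
  fix z \<theta> :: "complex ^ 'n"
  assume z: "z \<in> ball 0 1" and \<theta>: "norm \<theta> = 1"
  define V where "V = {\<zeta> :: complex. ereal (norm \<zeta>) < boundary_dist (ball 0 1) z}"
  have inV: "z + \<zeta> *s \<theta> \<in> ball 0 1" if "\<zeta> \<in> V" for \<zeta>
    by (rule within_boundary_dist[OF z]) (use that \<theta> in \<open>simp add: V_def norm_vscale\<close>)
  show "harmonic_on {\<zeta>. ereal (norm \<zeta>) < boundary_dist (ball 0 1) z}
     (\<lambda>\<zeta>. h ((z + \<zeta> *s \<theta>) $ j) + cnj (h ((z + \<zeta> *s \<theta>) $ j)))"
    unfolding harmonic_on_def V_def[symmetric]
  proof (intro conjI ballI)
    have in1: "z $ j + \<zeta> * \<theta> $ j \<in> ball 0 1" if "\<zeta> \<in> V" for \<zeta>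
      using comp_lt[OF inV[OF that]] by simp
    show "C2_on V (\<lambda>\<zeta>. h ((z + \<zeta> *s \<theta>) $ j) + cnj (h ((z + \<zeta> *s \<theta>) $ j)))"
      using C2_on_two_re[OF h open_ball bounded_linear_mult_left in1] by simp
    fix \<zeta> assume \<zeta>: "\<zeta> \<in> V"
    define U where "U = {\<zeta>. z $ j + \<zeta> * \<theta> $ j \<in> ball 0 1}"
    have "open U" unfolding U_def
      by (intro open_vimage[OF open_ball, unfolded vimage_def] continuous_intros)
    moreover have "(\<lambda>\<zeta>. h (z $ j + \<zeta> * \<theta> $ j)) holomorphic_on U"
      by (rule holomorphic_on_compose_gen[OF _ h, unfolded o_def]) (auto simp: U_def intro!: holomorphic_intros)
    moreover have "\<zeta> \<in> U" using in1[OF \<zeta>] by (simp add: U_def)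
    ultimately show "dir_deriv 1 (dir_deriv 1 (\<lambda>\<zeta>. h ((z + \<zeta> *s \<theta>) $ j) + cnj (h ((z + \<zeta> *s \<theta>) $ j)))) \<zeta> +
      dir_deriv \<i> (dir_deriv \<i> (\<lambda>\<zeta>. h ((z + \<zeta> *s \<theta>) $ j) + cnj (h ((z + \<zeta> *s \<theta>) $ j)))) \<zeta> = 0"
      using laplacian_two_re[of "\<lambda>\<zeta>. h (z $ j + \<zeta> * \<theta> $ j)" U \<zeta>] by simp
  qed
qed

text \<open>The conformal map of the unit disc onto the strip \<open>\<bar>Re\<bar> < 1/2\<close>; twice its real part is
\<open>(2/\<pi>) arg ((1 + w) / (1 - w))\<close>.\<close>

definition strip_map :: "complex \<Rightarrow> complex"
  where "strip_map w = Ln ((1 + w) / (1 - w)) / (of_real pi * \<i>)"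

lemma halfplane_map_Re_pos:
  assumes "norm w < 1"
  shows "Re ((1 + w) / (1 - w)) > 0"
proof -
  have "Re ((1 + w) * cnj (1 - w)) = 1 - (norm w)\<^sup>2"
    unfolding cmod_power2 by (simp add: power2_eq_square algebra_simps)
  then show ?thesis
    using assms unfolding Re_complex_div_gt_0 by (simp add: power_less_one_iff)
qed

lemma strip_map_has_derivative:
  assumes "norm w < 1"
  shows "(strip_map has_field_derivative (inverse ((1 + w) / (1 - w)) * (2 / (1 - w)\<^sup>2)) / (of_real pi * \<i>)) (at w)"
proof -
  have w1: "1 - w \<noteq> 0" using assms by auto
  have "(1 + w) / (1 - w) \<notin> \<real>\<^sub>\<le>\<^sub>0"
    using halfplane_map_Re_pos[OF assms] by (auto simp: complex_nonpos_Reals_iff)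
  then have Ln: "(Ln has_field_derivative inverse ((1 + w) / (1 - w))) (at ((1 + w) / (1 - w)))"
    by (rule has_field_derivative_Ln)
  have "((\<lambda>w. (1 + w) / (1 - w)) has_field_derivative ((0 + 1) * (1 - w) - (1 + w) * (0 - 1)) / ((1 - w) * (1 - w))) (at w)"
    by (intro DERIV_divide DERIV_add DERIV_diff DERIV_const DERIV_ident w1)
  then have q: "((\<lambda>w. (1 + w) / (1 - w)) has_field_derivative 2 / (1 - w)\<^sup>2) (at w)"
    by (simp add: power2_eq_square)
  show ?thesis unfolding strip_map_def by (rule DERIV_cdivide[OF DERIV_chain2[OF Ln q]])
qed

lemma strip_map_two_re_bound:
  assumes "norm w < 1"
  shows "norm (strip_map w + cnj (strip_map w)) < 1"
proof -
  let ?q = "(1 + w) / (1 - w)"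
  have q: "Re ?q > 0" by (rule halfplane_map_Re_pos[OF assms])
  have "strip_map w + cnj (strip_map w) = of_real (2 * Re (strip_map w))" by (simp add: complex_add_cnj)
  also have "Re (strip_map w) = Im (Ln ?q) / pi"
    unfolding strip_map_def by (simp add: Re_divide power2_eq_square)
  finally have "norm (strip_map w + cnj (strip_map w)) = 2 * \<bar>Im (Ln ?q)\<bar> / pi"
    by (simp only: norm_of_real) (simp add: abs_mult)
  moreover have "\<bar>Im (Ln ?q)\<bar> < pi / 2" using Re_Ln_pos_lt_imp[OF q] q by auto
  ultimately show ?thesis by (simp add: divide_less_eq)
qed

lemma strip_map_power_coeff:
  assumes m: "m \<ge> 1"
  defines "h \<equiv> (\<lambda>\<zeta>. strip_map (\<zeta> ^ m))"
  shows "h holomorphic_on ball 0 1" and "(deriv ^^ m) h 0 = fact m * (2 / (of_real pi * \<i>))"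
proof -
  have k: "strip_map holomorphic_on ball 0 1"
    unfolding holomorphic_on_def field_differentiable_def
    using strip_map_has_derivative has_field_derivative_at_within by (metis mem_ball_0)
  show "h holomorphic_on ball 0 1" unfolding h_def
    by (rule holomorphic_on_compose_gen[OF _ k, unfolded o_def])
      (use m in \<open>auto intro!: holomorphic_intros simp: norm_power power_less_one_iff\<close>)
  define K where "K = fps_expansion strip_map 0"
  have K: "strip_map has_fps_expansion K"
    unfolding K_def by (rule has_fps_expansion_fps_expansion[OF open_ball _ k]) simp
  have "(strip_map \<circ> (\<lambda>\<zeta>. \<zeta> ^ m)) has_fps_expansion fps_compose K (fps_X ^ m)"
    using m by (intro has_fps_expansion_compose K has_fps_expansion_fps_X_power) (simp add: fps_X_power_nth)
  then have H: "h has_fps_expansion fps_compose K (fps_X ^ m)" by (simp add: h_def o_def)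
  have "(deriv ^^ m) h 0 / fact m = fps_nth (fps_compose K (fps_X ^ m)) m"
    using fps_nth_fps_expansion[OF H] by simp
  also have "\<dots> = (\<Sum>i=0..m. fps_nth K i * fps_nth ((fps_X ^ m) ^ i) m)" by (rule fps_compose_nth)
  also have "\<dots> = (\<Sum>i=0..m. if i = 1 then fps_nth K 1 else 0)"
    using m by (intro sum.cong refl) (auto simp: power_mult[symmetric] fps_X_power_nth)
  also have "\<dots> = fps_nth K 1" using m by simp
  also have "\<dots> = deriv strip_map 0" using fps_nth_fps_expansion[OF K, of 1] by simp
  also have "\<dots> = 2 / (of_real pi * \<i>)" using DERIV_imp_deriv[OF strip_map_has_derivative[of 0]] by simp
  finally show "(deriv ^^ m) h 0 = fact m * (2 / (of_real pi * \<i>))" by (simp add: field_simps)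
qed

lemma cdir_power_two_re:
  fixes j :: "'n::finite"
  assumes h: "h holomorphic_on ball 0 1" and m: "m \<ge> 1"
  shows "(cdir (axis j 1) ^^ m) (\<lambda>z :: complex ^ 'n. h (z $ j) + cnj (h (z $ j))) 0 = (deriv ^^ m) h 0"
proof -
  define g where "g = (\<lambda>z :: complex ^ 'n. h (z $ j) + cnj (h (z $ j)))"
  have flat: "levi_flat_on (ball 0 1) g"
    unfolding g_def by (rule pluriharmonic_imp_levi_flat[OF open_ball pluriharmonic_two_re[OF h]])
  have sub: "(0 :: complex ^ 'n) + \<zeta> *s axis j 1 \<in> ball 0 1" if "norm \<zeta> < 1" for \<zeta>
    using that by (simp add: norm_vscale)
  have K: "deriv h \<zeta> = cdir (axis j 1) g (0 + \<zeta> *s axis j 1)" if "norm \<zeta> < 1" for \<zeta>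
  proof -
    let ?x = "\<zeta> *s axis j 1 :: complex ^ 'n"
    have x: "?x $ j = \<zeta>" by (simp add: axis_def)
    have "(h has_derivative (*) (deriv h \<zeta>)) (at (?x $ j))"
      using holomorphic_derivI[OF h open_ball, of \<zeta>] that by (simp add: x has_field_derivative_def)
    from has_derivative_compose[OF bounded_linear_imp_has_derivative[OF bounded_linear_vec_nth] this]
    have d: "((\<lambda>z. h (z $ j)) has_derivative (\<lambda>v. deriv h \<zeta> * v $ j)) (at ?x)" .
    from cdir_eq[OF has_derivative_add[OF d bounded_linear.has_derivative[OF bounded_linear_cnj d]], of "axis j 1"]
    show ?thesis by (simp add: g_def axis_def algebra_simps)
  qed
  obtain n where n: "m = Suc n" using m by (cases m) auto
  have "(deriv ^^ n) (deriv h) 0 = (cdir (axis j 1) ^^ n) (cdir (axis j 1) g) (0 + 0 *s axis j 1)"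
    by (rule higher_deriv_line[OF open_ball levi_flat_cdir(1)[OF open_ball flat] sub K]) auto
  then show ?thesis unfolding n funpow_Suc_right o_apply g_def[symmetric] by simp
qed

section \<open>Iterated Wirtinger derivatives\<close>

lemma wirtinger_eq_cdir: "wirtinger j = cdir (axis j 1)"
proof -
  have "\<i> *s axis j 1 = axis j \<i>" by (simp add: vec_eq_iff axis_def)
  then show ?thesis by (intro ext) (simp add: wirtinger_def cdir_def)
qed

lemma foldr_wirtinger: "foldr wirtinger w f = word_deriv w f"
  unfolding word_deriv_def wirtinger_eq_cdir[abs_def] by (rule refl)

lemma wirtinger_bar_cnj:
  assumes "(k has_derivative D) (at x)"
  shows "wirtinger_bar j (\<lambda>y. cnj (k y)) x = cnj (wirtinger j k x)"
  unfolding wirtinger_bar_def wirtinger_def dir_deriv_eq[OF assms]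
    dir_deriv_eq[OF bounded_linear.has_derivative[OF bounded_linear_cnj assms]]
  by simp

lemma wirtinger_bar_cong:
  assumes "open S" "x \<in> S" "\<And>y. y \<in> S \<Longrightarrow> f y = g y"
  shows "wirtinger_bar j f x = wirtinger_bar j g x"
  unfolding wirtinger_bar_def by (simp only: dir_deriv_cong[OF assms])

text \<open>Conjugation exchanges the two Wirtinger derivatives of a function, provided that it is differentiable;
the intermediate derivatives are, by the regularity of the conjugate of \<open>f\<close>.\<close>

lemma foldr_wirtinger_bar:
  assumes S: "open S" and f: "levi_flat_on S f" and x: "x \<in> S"
  shows "foldr wirtinger_bar w f x = cnj (word_deriv w (\<lambda>y. cnj (f y)) x)"
  using x
proof (induction w arbitrary: x)
  case Nil
  then show ?case by simp
next
  case (Cons j w)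
  obtain D where D: "(word_deriv w (\<lambda>y. cnj (f y)) has_derivative D) (at x)"
    using cdir_regularD(1)[OF cdir_regular_word_deriv[OF S levi_flat_imp_cdir_regular[OF S levi_flat_cnj[OF f]]] Cons.prems]
    by blast
  have "foldr wirtinger_bar (j # w) f x = wirtinger_bar j (\<lambda>y. cnj (word_deriv w (\<lambda>y. cnj (f y)) y)) x"
    unfolding foldr.simps o_apply by (rule wirtinger_bar_cong[OF S Cons.prems Cons.IH])
  then show ?case by (simp only: wirtinger_bar_cnj[OF D] wirtinger_eq_cdir word_deriv_simps)
qed

lemma foldr_replicate_funpow: "foldr D (replicate n j) f = (D j ^^ n) f"
  by (induction n) auto

lemma foldr_funpow_concat:
  "foldr (\<lambda>j. D j ^^ m j) xs f = foldr D (concat (map (\<lambda>j. replicate (m j) j) xs)) f"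
  by (induction xs) (auto simp: foldr_replicate_funpow)

definition multi_word :: "('n::{finite,linorder} \<Rightarrow> nat) \<Rightarrow> 'n list"
  where "multi_word m = concat (map (\<lambda>j. replicate (m j) j) (sorted_list_of_set UNIV))"

lemma multi_deriv_eq_foldr: "multi_deriv D m f = foldr D (multi_word m) f"
  unfolding multi_deriv_def multi_word_def by (rule foldr_funpow_concat)

lemma count_multi_word: "count (mset (multi_word m)) i = m i"
proof -
  have "count (mset (concat (map (\<lambda>j. replicate (m j) j) xs))) i = (if i \<in> set xs then m i else 0)"
    if "distinct xs" for xs :: "'a::{finite,linorder} list" and m i
    using that by (induction xs) auto
  then show ?thesis unfolding multi_word_def by simp
qed

text \<open>The estimate in the direction of a coordinate axis.\<close>

lemma wirtinger_power_bound:
  fixes f :: "complex ^ 'n::finite \<Rightarrow> complex"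
  assumes f: "levi_flat_on (ball 0 1) f" and bd: "\<And>x. x \<in> ball 0 1 \<Longrightarrow> norm (f x) \<le> 1"
    and z: "z \<in> ball 0 1" and m: "m \<ge> 1"
  shows "norm ((wirtinger j ^^ m) f z) + norm ((wirtinger_bar j ^^ m) f z)
           \<le> 4 / pi * fact m * ((1 + norm z) ^ (m - 1) / (1 - (norm z)\<^sup>2) ^ m)"
proof -
  have nz: "norm z < 1" using z by simp
  have s: "1 - (norm z)\<^sup>2 > 0" using nz by (simp add: power_less_one_iff)
  have "(wirtinger_bar j ^^ m) f z = cnj ((cdir (axis j 1) ^^ m) (\<lambda>y. cnj (f y)) z)"
    using foldr_wirtinger_bar[OF open_ball f z, of "replicate m j"]
    unfolding foldr_wirtinger[symmetric] foldr_replicate_funpow wirtinger_eq_cdir .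
  then have "norm ((wirtinger j ^^ m) f z) + norm ((wirtinger_bar j ^^ m) f z)
      = norm ((cdir (axis j 1) ^^ m) f z) + norm ((cdir (axis j 1) ^^ m) (\<lambda>x. cnj (f x)) z)"
    by (simp add: wirtinger_eq_cdir)
  also have "\<dots> \<le> 4 / pi * fact m * (norm (axis j 1 :: complex ^ 'n) * (norm (axis j 1 :: complex ^ 'n)
      + norm (\<Sum>i\<in>UNIV. z $ i * cnj (axis j 1 $ i))) ^ (m - 1) / (1 - (norm z)\<^sup>2) ^ m)"
    by (rule direction_derivative_bound[OF f bd nz m]) (auto simp: axis_eq_0_iff)
  also have "(\<Sum>i\<in>UNIV. z $ i * cnj (axis j 1 $ i)) = z $ j"
  proof -
    have "(\<Sum>i\<in>UNIV. z $ i * cnj (axis j 1 $ i)) = (\<Sum>i\<in>UNIV. if i = j then z $ i else 0)"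
      by (intro sum.cong refl) (simp add: axis_def)
    then show ?thesis by simp
  qed
  also have "norm (axis j 1 :: complex ^ 'n) = 1" by simp
  also have "4 / pi * fact m * (1 * (1 + norm (z $ j)) ^ (m - 1) / (1 - (norm z)\<^sup>2) ^ m)
      \<le> 4 / pi * fact m * ((1 + norm z) ^ (m - 1) / (1 - (norm z)\<^sup>2) ^ m)"
    using s Finite_Cartesian_Product.norm_nth_le[of z j]
    by (intro mult_left_mono divide_right_mono) (auto intro!: power_mono)
  finally show ?thesis .
qed

text \<open>The function \<open>2 Re (strip_map (\<zeta>^m))\<close> of one coordinate \<open>\<zeta>\<close>: substituting \<open>\<zeta>^m\<close> moves the first Taylor
coefficient \<open>2/(\<pi> \<i>)\<close> of \<open>strip_map\<close> to degree \<open>m\<close>. The function is real, so both derivatives at \<open>0\<close> have the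
same modulus.\<close>

lemma wirtinger_power_constant_sharp:
  fixes j :: "'n::finite"
  assumes m: "m \<ge> 1"
  obtains g :: "complex ^ 'n \<Rightarrow> complex" where "pluriharmonic_on (ball 0 1) g" "g ` ball 0 1 \<subseteq> ball 0 1"
    "norm ((wirtinger j ^^ m) g 0) + norm ((wirtinger_bar j ^^ m) g 0) = 4 / pi * fact m"
proof -
  define h where "h = (\<lambda>\<zeta>. strip_map (\<zeta> ^ m))"
  have h: "h holomorphic_on ball 0 1" and hm: "(deriv ^^ m) h 0 = fact m * (2 / (of_real pi * \<i>))"
    using strip_map_power_coeff[OF m] unfolding h_def by auto
  define g where "g = (\<lambda>z :: complex ^ 'n. h (z $ j) + cnj (h (z $ j)))"
  have ph: "pluriharmonic_on (ball 0 1) g" unfolding g_def by (rule pluriharmonic_two_re[OF h])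
  have flat: "levi_flat_on (ball 0 1) g" by (rule pluriharmonic_imp_levi_flat[OF open_ball ph])
  have g_real: "(\<lambda>y. cnj (g y)) = g" by (simp add: g_def fun_eq_iff add.commute)
  have "g z \<in> ball 0 1" if "z \<in> ball 0 1" for z
  proof -
    have "norm (z $ j) < 1" using that Finite_Cartesian_Product.norm_nth_le[of z j] by simp
    then have "norm ((z $ j) ^ m) < 1" using m by (simp add: norm_power power_less_one_iff)
    then show ?thesis using strip_map_two_re_bound by (simp add: g_def h_def)
  qed
  moreover have D: "(cdir (axis j 1) ^^ m) g 0 = fact m * (2 / (of_real pi * \<i>))"
    unfolding g_def using cdir_power_two_re[OF h m] hm by simp
  moreover have "(wirtinger_bar j ^^ m) g 0 = cnj ((cdir (axis j 1) ^^ m) g 0)"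
    using foldr_wirtinger_bar[OF open_ball flat, of 0 "replicate m j"]
    unfolding foldr_wirtinger[symmetric] foldr_replicate_funpow wirtinger_eq_cdir g_real by simp
  moreover have "norm (fact m * (2 / (of_real pi * \<i>)) :: complex) = 2 / pi * fact m"
    by (simp add: norm_mult norm_divide)
  ultimately have "norm ((wirtinger j ^^ m) g 0) + norm ((wirtinger_bar j ^^ m) g 0) = 4 / pi * fact m"
    by (simp only: wirtinger_eq_cdir complex_mod_cnj)
  then show thesis using that[OF ph] \<open>\<And>z. z \<in> ball 0 1 \<Longrightarrow> g z \<in> ball 0 1\<close> by blast
qed

lemma norm_sum_product_le:
  fixes z \<theta> :: "complex ^ 'n::finite"
  shows "norm \<theta> + norm (\<Sum>j\<in>UNIV. z $ j * cnj (\<theta> $ j)) \<le> (\<Sum>j\<in>UNIV. norm (\<theta> $ j) * (1 + norm (z $ j)))"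
proof -
  have "norm \<theta> \<le> (\<Sum>j\<in>UNIV. norm (\<theta> $ j))"
    unfolding norm_vec_def by (rule L2_set_le_sum) simp
  moreover have "norm (\<Sum>j\<in>UNIV. z $ j * cnj (\<theta> $ j)) \<le> (\<Sum>j\<in>UNIV. norm (z $ j * cnj (\<theta> $ j)))"
    by (rule norm_sum)
  ultimately show ?thesis by (simp add: norm_mult sum.distrib distrib_left mult.commute)
qed

text \<open>The torus \<open>\<bar>\<theta>\<^sub>j\<bar> = m\<^sub>j / (1 + \<bar>z\<^sub>j\<bar>)\<close> is chosen so that \<open>\<parallel>\<theta>\<parallel> + \<bar>\<langle>z,\<theta>\<rangle>\<bar>\<close> is at most \<open>M\<close> on it. The resulting factor
\<open>m! M^M / m^m\<close> is controlled by the largest multinomial term.\<close>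

lemma multi_deriv_bound:
  fixes f :: "complex ^ 'n::{finite,linorder} \<Rightarrow> complex" and mm :: "'n \<Rightarrow> nat"
  assumes f: "levi_flat_on (ball 0 1) f" and bd: "\<And>x. x \<in> ball 0 1 \<Longrightarrow> norm (f x) \<le> 1"
    and z: "z \<in> ball 0 1" and mm: "mm \<noteq> (\<lambda>_. 0)"
  shows "norm (multi_deriv wirtinger mm f z) + norm (multi_deriv wirtinger_bar mm f z)
     \<le> 4 / pi * real ((CARD('n) + multi_order mm - 1) choose (CARD('n) - 1)) * fact (multi_order mm)
        * ((\<Prod>j\<in>UNIV. (1 + norm (z $ j)) ^ mm j) / (1 - (norm z)\<^sup>2) ^ multi_order mm)"
proof -
  define M where "M = multi_order mm"
  have M: "M = (\<Sum>j\<in>UNIV. mm j)" by (simp add: M_def multi_order_def)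
  obtain i where i: "mm i > 0" using mm by (auto simp: fun_eq_iff)
  then have M1: "M \<ge> 1" using member_le_sum[of i UNIV mm] by (simp add: M)
  have nz: "norm z < 1" using z by simp
  define s where "s = 1 - (norm z)\<^sup>2"
  have s: "s > 0" using nz by (simp add: s_def power_less_one_iff)
  define x where "x = (\<lambda>j. 1 + norm (z $ j))"
  have x: "x j > 0" for j by (simp add: x_def add_pos_nonneg)
  define r where "r = (\<lambda>j. real (mm j) / x j)"
  have r: "r j \<ge> 0" for j using x[of j] by (simp add: r_def)
  define X where "X = norm (multi_deriv wirtinger mm f z) + norm (multi_deriv wirtinger_bar mm f z)"
  define A where "A = (\<Prod>j\<in>UNIV. real (mm j) ^ mm j)"
  define B where "B = (\<Prod>j\<in>UNIV. x j ^ mm j)"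
  define F where "F = (\<Prod>j\<in>UNIV. fact (mm j) :: real)"
  have pos: "A > 0" "B > 0" "F > 0"
    unfolding A_def B_def F_def using x by (auto intro!: prod_pos)
  have X: "X = norm (word_deriv (multi_word mm) f z) + norm (word_deriv (multi_word mm) (\<lambda>y. cnj (f y)) z)"
    unfolding X_def multi_deriv_eq_foldr foldr_wirtinger foldr_wirtinger_bar[OF open_ball f z] by simp
  have dir: "norm ((cdir \<theta> ^^ M) f z) + norm ((cdir \<theta> ^^ M) (\<lambda>y. cnj (f y)) z) \<le> 4 / pi * fact M * (real M ^ M / s ^ M)"
    if \<theta>: "\<And>j. norm (\<theta> $ j) = r j" for \<theta>
  proof -
    define c where "c = norm (\<Sum>j\<in>UNIV. z $ j * cnj (\<theta> $ j))"
    have "r i > 0" using i x[of i] by (simp add: r_def)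
    then have "\<theta> \<noteq> 0" using \<theta>[of i] by auto
    from direction_derivative_bound[OF f bd nz M1 this]
    have "norm ((cdir \<theta> ^^ M) f z) + norm ((cdir \<theta> ^^ M) (\<lambda>y. cnj (f y)) z)
        \<le> 4 / pi * fact M * (norm \<theta> * (norm \<theta> + c) ^ (M - 1) / s ^ M)"
      by (simp add: c_def s_def)
    also have "\<dots> \<le> 4 / pi * fact M * (real M ^ M / s ^ M)"
    proof (intro mult_left_mono divide_right_mono)
      have "norm \<theta> + c \<le> (\<Sum>j\<in>UNIV. norm (\<theta> $ j) * x j)"
        unfolding c_def x_def by (rule norm_sum_product_le)
      also have "\<dots> = real M" using x by (simp add: \<theta> r_def M less_imp_neq[symmetric] order_less_imp_not_eq2)
      finally have le: "norm \<theta> + c \<le> real M" .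
      have c: "c \<ge> 0" by (simp add: c_def)
      have "norm \<theta> * (norm \<theta> + c) ^ (M - 1) \<le> real M * real M ^ (M - 1)"
        using le c by (intro mult_mono power_mono) auto
      also have "\<dots> = real M ^ M" using M1 by (cases M) auto
      finally show "norm \<theta> * (norm \<theta> + c) ^ (M - 1) \<le> real M ^ M" .
    qed (use s in auto)
    finally show ?thesis .
  qed
  have regf: "cdir_regular_on (ball 0 1) f" by (rule levi_flat_imp_cdir_regular[OF open_ball f])
  have regc: "cdir_regular_on (ball 0 1) (\<lambda>y. cnj (f y))"
    by (rule levi_flat_imp_cdir_regular[OF open_ball levi_flat_cnj[OF f]])
  have "(\<Prod>j\<in>UNIV. r j ^ mm j) * fact M * X \<le> 4 / pi * fact M * (real M ^ M / s ^ M) * F"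
    unfolding X F_def
    by (rule coefficient_bound_from_torus[OF open_ball regf regc z r count_multi_word M dir])
  moreover have "(\<Prod>j\<in>UNIV. r j ^ mm j) = A / B"
    by (simp add: A_def B_def r_def power_divide prod_dividef)
  ultimately have "fact M * (A / B * X) \<le> fact M * (4 / pi * (real M ^ M / s ^ M) * F)"
    by (simp add: mult_ac)
  then have "A / B * X \<le> 4 / pi * (real M ^ M / s ^ M) * F" by (rule mult_left_le_imp_le) simp
  then have "A * X \<le> 4 / pi * (real M ^ M / s ^ M) * F * B"
    using pos(2) by (simp add: field_simps)
  also have "\<dots> \<le> 4 / pi * ((fact M * (real ((CARD('n) + M - 1) choose M) * (A / F))) / s ^ M) * F * B"
  proof -
    have "(\<Sum>j\<in>(UNIV :: 'n set). real (mm j)) ^ M / fact M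
        \<le> real ((card (UNIV :: 'n set) + M - 1) choose M) * (\<Prod>j\<in>UNIV. real (mm j) ^ mm j / fact (mm j))"
      by (rule power_sum_div_fact_le) (auto intro: power_div_fact_le_diagonal)
    then have "real M ^ M \<le> fact M * (real ((CARD('n) + M - 1) choose M) * (A / F))"
      by (simp add: M[symmetric] A_def F_def prod_dividef field_simps flip: of_nat_sum)
    then show ?thesis using s pos by (intro mult_right_mono mult_left_mono divide_right_mono) auto
  qed
  also have "\<dots> = A * (4 / pi * real ((CARD('n) + M - 1) choose M) * fact M * (B / s ^ M))"
    using pos by (simp add: mult_ac)
  finally have "X \<le> 4 / pi * real ((CARD('n) + M - 1) choose M) * fact M * (B / s ^ M)"
    by (rule mult_left_le_imp_le) (rule pos(1))
  moreover have "(CARD('n) + M - 1) choose M = (CARD('n) + M - 1) choose (CARD('n) - 1)"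
  proof -
    have "CARD('n) > 0" by simp
    then have "M \<le> CARD('n) + M - 1" "CARD('n) + M - 1 - M = CARD('n) - 1" by linarith+
    then show ?thesis by (metis binomial_symmetric)
  qed
  ultimately show ?thesis by (simp add: X_def M_def B_def x_def s_def)
qed

theorem theorem2p8:
  fixes f :: "complex ^ 'n::{finite,linorder} \<Rightarrow> complex"
  assumes "pluriharmonic_on (ball 0 1) f"
    and "f ` ball 0 1 \<subseteq> ball 0 1"
  shows "(CARD('n) = 1 \<longrightarrow>
      (\<forall>j::'n::{finite,linorder}. \<forall>z\<in>ball 0 1. \<forall>m\<ge>1.
         norm ((wirtinger j ^^ m) f z) + norm ((wirtinger_bar j ^^ m) f z)
           \<le> 4 / pi * fact m * ((1 + norm z) ^ (m - 1) / (1 - (norm z)\<^sup>2) ^ m)) \<and>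
      (\<forall>m\<ge>1. \<forall>C::real.
         (\<forall>g :: complex ^ 'n::{finite,linorder} \<Rightarrow> complex.
            pluriharmonic_on (ball 0 1) g \<longrightarrow> g ` ball 0 1 \<subseteq> ball 0 1 \<longrightarrow>
            (\<forall>j::'n::{finite,linorder}. \<forall>z\<in>ball 0 1.
               norm ((wirtinger j ^^ m) g z) + norm ((wirtinger_bar j ^^ m) g z)
                 \<le> C * fact m * ((1 + norm z) ^ (m - 1) / (1 - (norm z)\<^sup>2) ^ m)))
         \<longrightarrow> 4 / pi \<le> C)) \<and>
    (CARD('n) \<ge> 2 \<longrightarrow>
      (\<forall>z\<in>ball 0 1. \<forall>m :: 'n::{finite,linorder} \<Rightarrow> nat. m \<noteq> (\<lambda>_. 0) \<longrightarrow>
         norm (multi_deriv wirtinger m f z) + norm (multi_deriv wirtinger_bar m f z)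
           \<le> 4 / pi * real CARD('n) powr (real (multi_order m) / 2)
             * real ((CARD('n) + multi_order m - 1) choose (CARD('n) - 1))
             * fact (multi_order m)
             * ((\<Prod>j\<in>UNIV. (1 + norm (z $ j)) ^ m j)
                 / (1 - (norm z)\<^sup>2) ^ multi_order m)))"
proof -
  have flat: "levi_flat_on (ball 0 1) f" by (rule pluriharmonic_imp_levi_flat[OF open_ball assms(1)])
  have bd: "norm (f x) \<le> 1" if "x \<in> ball 0 1" for x
    using assms(2) that by (force simp: image_subset_iff)
  show ?thesis
  proof (intro conjI impI ballI allI)
    show "norm ((wirtinger j ^^ m) f z) + norm ((wirtinger_bar j ^^ m) f z)
             \<le> 4 / pi * fact m * ((1 + norm z) ^ (m - 1) / (1 - (norm z)\<^sup>2) ^ m)"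
      if "z \<in> ball 0 1" "m \<ge> 1" for j z m
      by (rule wirtinger_power_bound[OF flat bd that])
    fix m :: nat and C :: real
    assume m: "m \<ge> 1" and C: "\<forall>g :: complex ^ 'n::{finite,linorder} \<Rightarrow> complex.
              pluriharmonic_on (ball 0 1) g \<longrightarrow> g ` ball 0 1 \<subseteq> ball 0 1 \<longrightarrow>
              (\<forall>j::'n::{finite,linorder}. \<forall>z\<in>ball 0 1.
                 norm ((wirtinger j ^^ m) g z) + norm ((wirtinger_bar j ^^ m) g z)
                   \<le> C * fact m * ((1 + norm z) ^ (m - 1) / (1 - (norm z)\<^sup>2) ^ m))"
    obtain g :: "complex ^ 'n::{finite,linorder} \<Rightarrow> complex" where g: "pluriharmonic_on (ball 0 1) g" "g ` ball 0 1 \<subseteq> ball 0 1"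
      "norm ((wirtinger undefined ^^ m) g 0) + norm ((wirtinger_bar undefined ^^ m) g 0) = 4 / pi * fact m"
      using wirtinger_power_constant_sharp[OF m, of undefined] by blast
    have "4 / pi * fact m \<le> C * fact m * ((1 + norm (0 :: complex ^ 'n::{finite,linorder})) ^ (m - 1) / (1 - (norm (0 :: complex ^ 'n::{finite,linorder}))\<^sup>2) ^ m)"
      unfolding g(3)[symmetric] by (rule C[rule_format, OF g(1,2)]) simp
    then have "4 / pi * fact m \<le> C * fact m" by simp
    then show "4 / pi \<le> C" by (rule mult_right_le_imp_le) simp
  next
    fix z :: "complex ^ 'n::{finite,linorder}" and m :: "'n \<Rightarrow> nat"
    assume z: "z \<in> ball 0 1" and m: "m \<noteq> (\<lambda>_. 0)"
    define R where "R = real ((CARD('n) + multi_order m - 1) choose (CARD('n) - 1)) * fact (multi_order m)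
               * ((\<Prod>j\<in>UNIV. (1 + norm (z $ j)) ^ m j) / (1 - (norm z)\<^sup>2) ^ multi_order m)"
    have "norm z < 1" using z by simp
    then have s: "1 - (norm z)\<^sup>2 > 0" by (simp add: power_less_one_iff)
    have R: "R \<ge> 0" unfolding R_def using s by (intro mult_nonneg_nonneg divide_nonneg_nonneg prod_nonneg) auto
    have "norm (multi_deriv wirtinger m f z) + norm (multi_deriv wirtinger_bar m f z) \<le> 4 / pi * 1 * R"
      using multi_deriv_bound[OF flat bd z m] by (simp only: R_def mult.assoc mult_1)
    also have "\<dots> \<le> 4 / pi * real CARD('n) powr (real (multi_order m) / 2) * R"
      using R by (intro mult_right_mono mult_left_mono ge_one_powr_ge_zero) auto
    finally show "norm (multi_deriv wirtinger m f z) + norm (multi_deriv wirtinger_bar m f z)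
             \<le> 4 / pi * real CARD('n) powr (real (multi_order m) / 2)
               * real ((CARD('n) + multi_order m - 1) choose (CARD('n) - 1))
               * fact (multi_order m)
               * ((\<Prod>j\<in>UNIV. (1 + norm (z $ j)) ^ m j)
                   / (1 - (norm z)\<^sup>2) ^ multi_order m)"
      by (simp only: R_def mult.assoc)
  qed
qed

end
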